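(* Let $\mathcal{A}$ be a $C^*$-algebra, $\mathcal{B}$ a $C^*$-subalgebra of $\mathcal{A}$, and $\mathcal{E}:\mathcal{A}\to\mathcal{B}$ a tracial conditional expectation. Let $\alpha\in[0,1]$. Then $$\left|\mathrm{Re}\big(\mathrm{Corr}^{\alpha}_{\rho,\mathcal{E}}(A,B)\big)\right|^2\;\leq\; I^{\alpha}_{\rho,\mathcal{E}}(A)\,I^{\alpha}_{\rho,\mathcal{E}}(B)$$ for all self-adjoint $A,B\in\mathcal{A}$ and each $\mathcal{E}$-density operator $\rho\in\mathcal{A}$.
   Context: A conditional expectation $\mathcal{E}:\mathcal{A}\to\mathcal{B}$ is a positive contractive linear map such that $\mathcal{E}(BAC)=B\mathcal{E}(A)C$ for all $A\in\mathcal{A}$ and $B,C\in\mathcal{B}$. It is tracial if $\mathcal{E}(XY)=\mathcal{E}(YX)$ for all $X,Y\in\mathcal{A}$. An $\mathcal{E}$-density operator is a positive $\rho\in\mathcal{A}$ with $\mathcal{E}(\rho)=I$, the unit. $|X|=(X^*X)^{1/2}$, $\mathrm{Re}(X)=\frac12(X+X^* )$. The generalized correlation and the generalized Wigner--Yanase--Dyson skew information are $$\mathrm{Corr}^{\alpha}_{\rho,\mathcal{E}}(A,B)=\mathcal{E}(\rho A^*B)-\mathcal{E}(\rho^{1-\alpha}A^*\rho^{\alpha}B),\qquad I^{\alpha}_{\rho,\mathcal{E}}(A)=\mathrm{Corr}^{\alpha}_{\rho,\mathcal{E}}(A,A),$$ with $\rho^0=I$. *)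

theory Defs
  imports "HOL-Analysis.Analysis" "HOL-Computational_Algebra.Polynomial"
begin

text \<open>Unital complex C*-algebras as a type class. The norm, completeness, the unit and the real
  scalars come from the library classes; the complex scalars extend the real ones.\<close>

class cstar_algebra = real_normed_algebra_1 + banach +
  fixes scaleC :: "complex \<Rightarrow> 'a \<Rightarrow> 'a" (infixr "*\<^sub>C" 75)
    and star :: "'a \<Rightarrow> 'a" ("_\<^sup>\<star>" [1000] 999)
  assumes scaleR_scaleC: "scaleR r x = complex_of_real r *\<^sub>C x"
    and scaleC_add_right: "c *\<^sub>C (x + y) = c *\<^sub>C x + c *\<^sub>C y"
    and scaleC_add_left: "(c + d) *\<^sub>C x = c *\<^sub>C x + d *\<^sub>C x"
    and scaleC_scaleC: "c *\<^sub>C (d *\<^sub>C x) = (c * d) *\<^sub>C x"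
    and mult_scaleC_left: "(c *\<^sub>C x) * y = c *\<^sub>C (x * y)"
    and mult_scaleC_right: "x * (c *\<^sub>C y) = c *\<^sub>C (x * y)"
    and norm_scaleC: "norm (c *\<^sub>C x) = cmod c * norm x"
    and star_star: "(x\<^sup>\<star>)\<^sup>\<star> = x"
    and star_add: "(x + y)\<^sup>\<star> = x\<^sup>\<star> + y\<^sup>\<star>"
    and star_scaleC: "(c *\<^sub>C x)\<^sup>\<star> = cnj c *\<^sub>C x\<^sup>\<star>"
    and star_mult: "(x * y)\<^sup>\<star> = y\<^sup>\<star> * x\<^sup>\<star>"
    and cstar_identity: "norm (x\<^sup>\<star> * x) = (norm x)\<^sup>2"

definition self_adjoint :: "'a::cstar_algebra \<Rightarrow> bool" where
  "self_adjoint a \<longleftrightarrow> a\<^sup>\<star> = a"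

definition cspectrum :: "'a::cstar_algebra \<Rightarrow> complex set" where
  "cspectrum a = {z. \<not> (\<exists>y. (a - z *\<^sub>C 1) * y = 1 \<and> y * (a - z *\<^sub>C 1) = 1)}"

definition cstar_positive :: "'a::cstar_algebra \<Rightarrow> bool" where
  "cstar_positive a \<longleftrightarrow>
     self_adjoint a \<and> (\<forall>z\<in>cspectrum a. z \<in> \<real> \<and> 0 \<le> Re z)"

definition cstar_le :: "'a::cstar_algebra \<Rightarrow> 'a \<Rightarrow> bool" (infix "\<le>\<^sub>A" 50) where
  "a \<le>\<^sub>A b \<longleftrightarrow> cstar_positive (b - a)"

text \<open>A C*-subalgebra is not required to contain the unit of the ambient algebra.\<close>

definition cstar_subalgebra :: "'a::cstar_algebra set \<Rightarrow> bool" where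
  "cstar_subalgebra B \<longleftrightarrow>
     0 \<in> B \<and>
     (\<forall>x\<in>B. \<forall>y\<in>B. x + y \<in> B \<and> x * y \<in> B) \<and>
     (\<forall>c. \<forall>x\<in>B. c *\<^sub>C x \<in> B) \<and>
     (\<forall>x\<in>B. x\<^sup>\<star> \<in> B) \<and>
     closed B"

definition poly_at :: "real poly \<Rightarrow> 'a::cstar_algebra \<Rightarrow> 'a" where
  "poly_at p a = (\<Sum>i\<le>degree p. coeff p i *\<^sub>R a ^ i)"

text \<open>Continuous functional calculus at a self-adjoint \<open>a\<close>: the extension by continuity of the
  polynomial calculus, for \<open>f\<close> continuous on the (compact, real) spectrum. By the Weierstrass
  theorem approximating sequences \<open>p\<close> exist, so the condition determines the value.\<close>

definition cfc :: "(real \<Rightarrow> real) \<Rightarrow> 'a::cstar_algebra \<Rightarrow> 'a" where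
  "cfc f a = (THE b. \<forall>p :: nat \<Rightarrow> real poly.
     uniform_limit {x. complex_of_real x \<in> cspectrum a} (\<lambda>n. poly (p n)) f sequentially
       \<longrightarrow> (\<lambda>n. poly_at (p n) a) \<longlonglongrightarrow> b)"

text \<open>Powers of a positive element with exponent in \<open>[0,\<infinity>)\<close>. The exponent \<open>0\<close> is separate because
  \<open>0 powr 0 = 0\<close> in the library, whereas the zeroth power is the unit.\<close>

definition cpow :: "'a::cstar_algebra \<Rightarrow> real \<Rightarrow> 'a" where
  "cpow a s = (if s = 0 then 1 else cfc (\<lambda>x. x powr s) a)"

definition cabs :: "'a::cstar_algebra \<Rightarrow> 'a" where
  "cabs x = cpow (x\<^sup>\<star> * x) (1/2)"

definition cRe :: "'a::cstar_algebra \<Rightarrow> 'a" where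
  "cRe x = (1/2) *\<^sub>R (x + x\<^sup>\<star>)"

text \<open>Positivity of \<open>E x\<close> is taken in the ambient algebra; by spectral permanence this is the
  same as positivity in \<open>B\<close>.\<close>

definition conditional_expectation :: "'a::cstar_algebra set \<Rightarrow> ('a \<Rightarrow> 'a) \<Rightarrow> bool" where
  "conditional_expectation B E \<longleftrightarrow>
     (\<forall>x. E x \<in> B) \<and>
     (\<forall>x y. E (x + y) = E x + E y) \<and>
     (\<forall>c x. E (c *\<^sub>C x) = c *\<^sub>C E x) \<and>
     (\<forall>x. cstar_positive x \<longrightarrow> cstar_positive (E x)) \<and>
     (\<forall>x. norm (E x) \<le> norm x) \<and>
     (\<forall>x. \<forall>b\<in>B. \<forall>c\<in>B. E (b * x * c) = b * E x * c)"

definition tracial :: "('a::cstar_algebra \<Rightarrow> 'a) \<Rightarrow> bool" where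
  "tracial E \<longleftrightarrow> (\<forall>x y. E (x * y) = E (y * x))"

definition density_operator :: "('a::cstar_algebra \<Rightarrow> 'a) \<Rightarrow> 'a \<Rightarrow> bool" where
  "density_operator E \<rho> \<longleftrightarrow> cstar_positive \<rho> \<and> E \<rho> = 1"

definition Corr :: "real \<Rightarrow> 'a::cstar_algebra \<Rightarrow> ('a \<Rightarrow> 'a) \<Rightarrow> 'a \<Rightarrow> 'a \<Rightarrow> 'a" where
  "Corr \<alpha> \<rho> E X Y =
     E (\<rho> * X\<^sup>\<star> * Y) - E (cpow \<rho> (1 - \<alpha>) * X\<^sup>\<star> * cpow \<rho> \<alpha> * Y)"

definition WYD_info :: "real \<Rightarrow> 'a::cstar_algebra \<Rightarrow> ('a \<Rightarrow> 'a) \<Rightarrow> 'a \<Rightarrow> 'a" where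
  "WYD_info \<alpha> \<rho> E X = Corr \<alpha> \<rho> E X X"

end

theory Submission
  imports Defs "HOL-Computational_Algebra.Fundamental_Theorem_Algebra"
begin

text \<open>The expectation carries the inequality into a commutative algebra. As \<open>E \<rho> = 1\<close>, the unit
  lies in \<open>B\<close> and every \<open>b\<close> in \<open>B\<close> is the value \<open>E (b * \<rho>)\<close>; being tracial, \<open>E\<close> then forces \<open>B\<close> to be
  commutative, and an element of \<open>B\<close> can be pulled out of \<open>E\<close> from any position in a product
  (\<open>B_commute\<close>, \<open>E_module_middle\<close>). So the forms \<open>E (\<rho>^(1-s) * X\<^sup>\<star> * \<rho>^s * Y)\<close>, for
  \<open>0 \<le> s \<le> 1\<close>, are sesquilinear over \<open>B\<close>. Write \<open>F s\<close> for their value at \<open>X = Y\<close>.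

  On self-adjoint arguments the real part of the correlation is half of the form for \<open>s = 0\<close> plus
  the one for \<open>s = 1\<close> minus those for \<open>s = \<alpha>\<close> and \<open>s = 1 - \<alpha>\<close>. This combination makes sense for all
  arguments, and it is positive: \<open>F s + F t - 2 F ((s + t) / 2)\<close> is \<open>E\<close> of a product \<open>W\<^sup>\<star> * W\<close>, so
  \<open>F\<close> is midpoint convex; being bounded, it lies below its chord over \<open>[0, 1]\<close>, and the chord
  inequalities at \<open>\<alpha>\<close> and \<open>1 - \<alpha>\<close> add up to the claim (\<open>symmetrized_corr_positive\<close>). The theorem is
  now the Cauchy--Schwarz inequality for a semi-inner product with values in a commutative algebra
  (\<open>module_Cauchy_Schwarz\<close>). Extending the form beyond self-adjoint arguments is what makes this
  possible, because multiples \<open>b * X\<close> by elements of \<open>B\<close> need not be self-adjoint.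

  All of this takes place in the cone of positive elements, which has to be closed under sums,
  limits and products of commuting elements, and to contain the squares of self-adjoint elements.
  These facts, like the functional calculus behind the powers of \<open>\<rho>\<close>, rest on one theorem: the norm
  of a self-adjoint element is attained on its spectrum (\<open>norm_attained_in_spectrum\<close>). It makes
  the polynomial calculus isometric for the supremum norm on the spectrum, and it describes
  positivity by the condition \<open>norm (t - a) \<le> t\<close>, which is visibly stable under sums and limits.\<close>

section \<open>Algebraic consequences of the axioms\<close>

lemma scaleC_zero_left [simp]: "(0::complex) *\<^sub>C (x::'a::cstar_algebra) = 0"
  using scaleC_add_left[of 0 0 x] by simp

lemma scaleC_zero_right [simp]: "c *\<^sub>C (0::'a::cstar_algebra) = 0"
  using scaleC_add_right[of c "0::'a" 0] by simp

lemma scaleC_one [simp]: "1 *\<^sub>C (x::'a::cstar_algebra) = x"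
  using scaleR_scaleC[of 1 x] by simp

lemma scaleC_minus_left [simp]: "(- c) *\<^sub>C (x::'a::cstar_algebra) = - (c *\<^sub>C x)"
  using scaleC_add_left[of "-c" c x] by (simp add: eq_neg_iff_add_eq_0)

lemma scaleC_minus_right [simp]: "c *\<^sub>C (- x) = - (c *\<^sub>C (x::'a::cstar_algebra))"
  using scaleC_add_right[of c "-x" x] by (simp add: eq_neg_iff_add_eq_0)

lemma scaleC_diff_left: "(c - d) *\<^sub>C (x::'a::cstar_algebra) = c *\<^sub>C x - d *\<^sub>C x"
  using scaleC_add_left[of c "-d" x] by simp

lemma scaleC_diff_right: "c *\<^sub>C (x - y) = c *\<^sub>C x - c *\<^sub>C (y::'a::cstar_algebra)"
  using scaleC_add_right[of c x "-y"] by simp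

lemma scaleC_power: "(c *\<^sub>C (x::'a::cstar_algebra)) ^ n = (c ^ n) *\<^sub>C x ^ n"
  by (induction n) (simp_all add: mult_scaleC_left mult_scaleC_right scaleC_scaleC mult.commute)

lemma star_zero [simp]: "(0::'a::cstar_algebra)\<^sup>\<star> = 0"
  using star_scaleC[of 0 "0::'a"] by simp

lemma star_minus [simp]: "(- x)\<^sup>\<star> = - ((x::'a::cstar_algebra)\<^sup>\<star>)"
  using star_scaleC[of "-1" x] by simp

lemma star_diff: "(x - y)\<^sup>\<star> = x\<^sup>\<star> - (y::'a::cstar_algebra)\<^sup>\<star>"
  using star_add[of x "-y"] by simp

lemma star_scaleR: "(r *\<^sub>R x)\<^sup>\<star> = r *\<^sub>R (x::'a::cstar_algebra)\<^sup>\<star>"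
  by (simp add: scaleR_scaleC star_scaleC)

lemma star_one [simp]: "(1::'a::cstar_algebra)\<^sup>\<star> = 1"
  using star_mult[of "(1::'a)\<^sup>\<star>" 1] by (simp add: star_star)

lemma star_power: "(x ^ n)\<^sup>\<star> = ((x::'a::cstar_algebra)\<^sup>\<star>) ^ n"
  by (induction n) (simp_all add: star_mult power_commutes)

lemma norm_star [simp]: "norm (x\<^sup>\<star>) = norm (x::'a::cstar_algebra)"
proof -
  have le: "norm y \<le> norm (y\<^sup>\<star>)" for y :: 'a
  proof (cases "norm y = 0")
    case False
    have "norm y * norm y \<le> norm (y\<^sup>\<star>) * norm y"
      using norm_mult_ineq[of "y\<^sup>\<star>" y] by (simp add: cstar_identity power2_eq_square)
    then show ?thesis using False by simp
  qed simp
  show ?thesis using le[of x] le[of "x\<^sup>\<star>"] by (simp add: star_star)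
qed

lemma tendsto_star:
  assumes "(f \<longlongrightarrow> l) F"
  shows "((\<lambda>n. (f n)\<^sup>\<star>) \<longlongrightarrow> (l::'a::cstar_algebra)\<^sup>\<star>) F"
proof -
  have "bounded_linear (star :: 'a \<Rightarrow> 'a)"
    by (rule bounded_linear_intro[of _ 1]) (simp_all add: star_add star_scaleR)
  then show ?thesis using assms by (rule bounded_linear.tendsto)
qed

lemma self_adjoint_simps:
  fixes a b :: "'a::cstar_algebra"
  shows "self_adjoint (0::'a)" "self_adjoint (1::'a)"
    and "self_adjoint a \<Longrightarrow> self_adjoint b \<Longrightarrow> self_adjoint (a + b)"
    and "self_adjoint a \<Longrightarrow> self_adjoint b \<Longrightarrow> self_adjoint (a - b)"
    and "self_adjoint a \<Longrightarrow> self_adjoint (- a)"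
    and "self_adjoint a \<Longrightarrow> self_adjoint (r *\<^sub>R a)"
    and "self_adjoint a \<Longrightarrow> self_adjoint (a ^ n)"
  by (simp_all add: self_adjoint_def star_add star_diff star_scaleR star_power)

text \<open>For a self-adjoint element the C*-identity reads \<open>norm (b * b) = (norm b)\<^sup>2\<close>, which is iterated
  here: an element of norm 1 has powers of norm 1, so they cannot tend to 0.\<close>

lemma norm_power_two_power:
  fixes a :: "'a::cstar_algebra"
  assumes "self_adjoint a"
  shows "norm (a ^ (2 ^ k)) = norm a ^ (2 ^ k)"
proof (induction k)
  case (Suc k)
  let ?b = "a ^ (2 ^ k)"
  have "norm (?b\<^sup>\<star> * ?b) = (norm ?b)\<^sup>2" by (rule cstar_identity)
  moreover have "?b\<^sup>\<star> = ?b" using assms by (simp add: star_power self_adjoint_def)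
  ultimately have "norm (?b * ?b) = (norm a ^ (2 ^ k))\<^sup>2" using Suc by simp
  then show ?case by (simp add: power_mult power2_eq_square mult.commute[of 2] power_mult_distrib)
qed simp

section \<open>Invertible elements\<close>

definition invertible_elt :: "'a::ring_1 \<Rightarrow> bool" where
  "invertible_elt x \<longleftrightarrow> (\<exists>y. x * y = 1 \<and> y * x = 1)"

definition inverse_elt :: "'a::ring_1 \<Rightarrow> 'a" where
  "inverse_elt x = (SOME y. x * y = 1 \<and> y * x = 1)"

lemma inverse_elt:
  assumes "invertible_elt x"
  shows "x * inverse_elt x = 1" "inverse_elt x * x = 1"
proof -
  have "x * inverse_elt x = 1 \<and> inverse_elt x * x = 1"
    using assms unfolding invertible_elt_def inverse_elt_def by (rule someI_ex)
  then show "x * inverse_elt x = 1" "inverse_elt x * x = 1" by auto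
qed

lemma inverse_elt_eqI:
  fixes x y :: "'a::ring_1"
  assumes "x * y = 1" "y * x = 1"
  shows "invertible_elt x" "inverse_elt x = y"
proof -
  show inv: "invertible_elt x" using assms by (auto simp: invertible_elt_def)
  have "inverse_elt x = inverse_elt x * (x * y)" using assms by simp
  also have "\<dots> = y" by (simp add: mult.assoc[symmetric] inverse_elt[OF inv])
  finally show "inverse_elt x = y" .
qed

lemma invertible_elt_mult:
  fixes x y :: "'a::ring_1"
  assumes "invertible_elt x" "invertible_elt y"
  shows "invertible_elt (x * y)"
proof (rule inverse_elt_eqI)
  let ?u = "inverse_elt x" and ?v = "inverse_elt y"
  have "x * y * (?v * ?u) = x * (y * ?v) * ?u" by (simp add: mult.assoc)
  then show "x * y * (?v * ?u) = 1" using assms by (simp add: inverse_elt)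
  have "?v * ?u * (x * y) = ?v * (?u * x) * y" by (simp add: mult.assoc)
  then show "?v * ?u * (x * y) = 1" using assms by (simp add: inverse_elt)
qed

lemma invertible_elt_scaleC:
  fixes x :: "'a::cstar_algebra"
  assumes "c \<noteq> 0" "invertible_elt x"
  shows "invertible_elt (c *\<^sub>C x)"
  by (rule inverse_elt_eqI[where y = "(1 / c) *\<^sub>C inverse_elt x"])
    (use assms in \<open>simp_all add: mult_scaleC_left mult_scaleC_right scaleC_scaleC inverse_elt\<close>)

lemma invertible_elt_minus:
  fixes x :: "'a::cstar_algebra"
  shows "invertible_elt (- x) \<longleftrightarrow> invertible_elt x"
  using invertible_elt_scaleC[of "-1" x] invertible_elt_scaleC[of "-1" "-x"] by auto

text \<open>The inverse is the geometric series.\<close>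

lemma invertible_elt_one_minus:
  fixes x :: "'a::{real_normed_algebra_1,banach}"
  assumes "norm x < 1"
  shows "invertible_elt (1 - x)"
proof -
  have sm: "summable (\<lambda>n. x ^ n)" by (rule complete_algebra_summable_geometric[OF assms])
  let ?s = "\<Sum>n. x ^ n"
  have "?s = 1 + (\<Sum>n. x ^ Suc n)"
    using suminf_split_head[OF sm] by simp
  moreover have "(\<Sum>n. x ^ Suc n) = x * ?s"
    using suminf_mult[OF sm, of x] by simp
  moreover have "(\<Sum>n. x ^ Suc n) = ?s * x"
    using suminf_mult2[OF sm, of x] by (simp add: power_commutes)
  ultimately have "(1 - x) * ?s = 1" "?s * (1 - x) = 1"
    by (simp_all add: algebra_simps)
  then show ?thesis by (rule inverse_elt_eqI)
qed

section \<open>The spectrum of a self-adjoint element\<close>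

lemma cspectrum_iff: "z \<in> cspectrum a \<longleftrightarrow> \<not> invertible_elt (a - z *\<^sub>C 1)"
  by (simp add: cspectrum_def invertible_elt_def)

lemma cspectrum_reflect:
  fixes a :: "'a::cstar_algebra"
  shows "z \<in> cspectrum (w *\<^sub>C 1 - a) \<longleftrightarrow> w - z \<in> cspectrum a"
proof -
  have "w *\<^sub>C 1 - a - z *\<^sub>C 1 = - (a - (w - z) *\<^sub>C 1)"
    by (simp add: scaleC_diff_left)
  then show ?thesis by (metis cspectrum_iff invertible_elt_minus)
qed

lemma cspectrum_shift:
  fixes a :: "'a::cstar_algebra"
  shows "z + w \<in> cspectrum (a + w *\<^sub>C 1) \<longleftrightarrow> z \<in> cspectrum a"
  by (simp add: cspectrum_iff scaleC_add_left)

lemma cspectrum_norm_le: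
  fixes a :: "'a::cstar_algebra"
  assumes "z \<in> cspectrum a"
  shows "cmod z \<le> norm a"
proof (rule ccontr)
  assume less: "\<not> ?thesis"
  then have z: "z \<noteq> 0" by auto
  have "norm ((1 / z) *\<^sub>C a) < 1" using less z by (simp add: norm_scaleC norm_divide field_simps)
  then have "invertible_elt (1 - (1 / z) *\<^sub>C a)" by (rule invertible_elt_one_minus)
  then have "invertible_elt ((- z) *\<^sub>C (1 - (1 / z) *\<^sub>C a))"
    using z by (intro invertible_elt_scaleC) auto
  moreover have "(- z) *\<^sub>C (1 - (1 / z) *\<^sub>C a) = a - z *\<^sub>C 1"
    using z by (simp add: scaleC_diff_right scaleC_scaleC)
  ultimately show False using assms by (simp add: cspectrum_iff)
qed

text \<open>Arens' trick: the shift \<open>a + it\<close> moves a spectral value \<open>x + iy\<close> to \<open>x + i(y + t)\<close>, whose squared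
  modulus grows like \<open>t\<^sup>2 + 2yt\<close>, while the C*-identity bounds the squared norm of \<open>a + it\<close> by
  \<open>(norm a)\<^sup>2 + t\<^sup>2\<close>. So \<open>2yt\<close> stays bounded for all real \<open>t\<close>.\<close>

lemma cspectrum_self_adjoint_real:
  fixes a :: "'a::cstar_algebra"
  assumes "self_adjoint a" "z \<in> cspectrum a"
  shows "z \<in> \<real>"
proof -
  have bound: "2 * Im z * t \<le> (norm a)\<^sup>2" for t
  proof -
    define b where "b = a + (\<i> * complex_of_real t) *\<^sub>C 1"
    have "b\<^sup>\<star> * b = a * a + (complex_of_real (t\<^sup>2)) *\<^sub>C 1"
      using assms(1) unfolding b_def self_adjoint_def
      by (simp add: star_add star_scaleC algebra_simps mult_scaleC_left mult_scaleC_right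
          scaleC_diff_right scaleC_scaleC power2_eq_square complex_cnj_mult)
    then have "norm (b\<^sup>\<star> * b) \<le> norm (a * a) + norm ((complex_of_real (t\<^sup>2)) *\<^sub>C (1::'a))"
      by (metis norm_triangle_ineq)
    also have "\<dots> \<le> (norm a)\<^sup>2 + t\<^sup>2"
      using norm_mult_ineq[of a a] by (simp add: norm_scaleC power2_eq_square norm_mult)
    finally have nb: "(norm b)\<^sup>2 \<le> (norm a)\<^sup>2 + t\<^sup>2" by (simp add: cstar_identity)
    have "z + \<i> * complex_of_real t \<in> cspectrum b"
      using assms(2) unfolding b_def by (simp add: cspectrum_shift)
    then have "cmod (z + \<i> * complex_of_real t) \<le> norm b" by (rule cspectrum_norm_le)
    then have "(cmod (z + \<i> * complex_of_real t))\<^sup>2 \<le> (norm b)\<^sup>2"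
      by (rule power_mono) simp
    then have "(Re z)\<^sup>2 + (Im z + t)\<^sup>2 \<le> (norm a)\<^sup>2 + t\<^sup>2"
      using nb by (simp add: cmod_power2)
    moreover have "(Im z + t)\<^sup>2 = (Im z)\<^sup>2 + 2 * Im z * t + t\<^sup>2"
      by (simp add: power2_eq_square algebra_simps)
    ultimately show ?thesis
      using zero_le_power2[of "Re z"] zero_le_power2[of "Im z"] by linarith
  qed
  have "Im z = 0"
  proof (rule ccontr)
    assume "Im z \<noteq> 0"
    then show False using bound[of "((norm a)\<^sup>2 + 1) / (2 * Im z)"] by simp
  qed
  then show ?thesis by (simp add: complex_is_Real_iff)
qed

text \<open>The partial fraction decomposition of \<open>1 / (1 - y\<^sup>2)\<close>. Iterating it averages the resolvent over
  the roots of unity of order \<open>2 ^ k\<close>.\<close>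

lemma inverse_one_minus_square:
  fixes y :: "'a::cstar_algebra"
  assumes "invertible_elt (1 - y)" "invertible_elt (1 + y)"
  shows "invertible_elt (1 - y * y)"
    and "inverse_elt (1 - y * y) = (1/2) *\<^sub>R (inverse_elt (1 - y) + inverse_elt (1 + y))"
proof -
  let ?p = "inverse_elt (1 - y)" and ?q = "inverse_elt (1 + y)"
  note p = inverse_elt[OF assms(1)] and q = inverse_elt[OF assms(2)]
  have f: "1 - y * y = (1 + y) * (1 - y)" "1 - y * y = (1 - y) * (1 + y)"
    by (simp_all add: algebra_simps)
  have "(1 - y * y) * ?p = 1 + y" "?q * (1 - y * y) = 1 - y"
    using p q by (simp_all add: f(1) mult.assoc) (simp add: mult.assoc[symmetric])
  moreover have "(1 - y * y) * ?q = 1 - y" "?p * (1 - y * y) = 1 + y"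
    using p q by (simp_all add: f(2) mult.assoc) (simp add: mult.assoc[symmetric])
  ultimately have "(1 - y * y) * (?p + ?q) = 2 *\<^sub>R 1" "(?p + ?q) * (1 - y * y) = 2 *\<^sub>R 1"
    by (simp_all only: distrib_left distrib_right) (simp_all add: scaleR_2)
  then have "(1 - y * y) * ((1/2) *\<^sub>R (?p + ?q)) = 1" "((1/2) *\<^sub>R (?p + ?q)) * (1 - y * y) = 1"
    by (simp_all only: mult_scaleR_left mult_scaleR_right scaleR_scaleR) simp_all
  then show "invertible_elt (1 - y * y)"
    and "inverse_elt (1 - y * y) = (1/2) *\<^sub>R (?p + ?q)"
    by (rule inverse_elt_eqI)+
qed

text \<open>The resolvent identity \<open>g v - g w = g w * (v - w) a * g v\<close> gives continuity as soon as \<open>g v\<close> is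
  bounded for \<open>v\<close> near \<open>w\<close>, and the same identity yields the bound \<open>norm (g v) \<le> 2 * norm (g w)\<close>.\<close>

lemma continuous_on_resolvent:
  fixes a :: "'a::cstar_algebra"
  assumes "\<And>w. w \<in> S \<Longrightarrow> invertible_elt (1 - w *\<^sub>C a)"
  shows "continuous_on S (\<lambda>w. inverse_elt (1 - w *\<^sub>C a))"
  unfolding continuous_on_iff
proof (intro ballI allI impI)
  fix w and e :: real assume w: "w \<in> S" and e: "0 < e"
  let ?g = "\<lambda>w. inverse_elt (1 - w *\<^sub>C a)"
  define K where "K = norm (?g w) * (norm a + 1)"
  have "?g w \<noteq> 0" using inverse_elt[OF assms[OF w]] by auto
  then have Kpos: "K > 0" by (simp add: K_def add_nonneg_pos)
  \<comment> \<open>The first bound on \<open>d\<close> serves to bound \<open>g v\<close>, the second to make the difference small.\<close>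
  define d where "d = min (1 / (2 * K)) (e / (2 * K * (norm (?g w) + 1)))"
  have dpos: "d > 0" using Kpos e by (simp add: d_def add_nonneg_pos)
  show "\<exists>d>0. \<forall>v\<in>S. dist v w < d \<longrightarrow> dist (?g v) (?g w) < e"
  proof (intro exI conjI ballI impI)
    fix v assume v: "v \<in> S" and vw: "dist v w < d"
    have "?g w * (1 - w *\<^sub>C a) * ?g v = ?g v" "?g w * (1 - v *\<^sub>C a) * ?g v = ?g w"
      by (simp_all only: mult.assoc inverse_elt(1)[OF assms[OF v]])
        (simp_all only: mult.assoc[symmetric] inverse_elt(2)[OF assms[OF w]], simp_all)
    then have "?g v - ?g w = ?g w * ((1 - w *\<^sub>C a) - (1 - v *\<^sub>C a)) * ?g v"
      by (simp only: left_diff_distrib right_diff_distrib)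
    also have "(1 - w *\<^sub>C a) - (1 - v *\<^sub>C a) = (v - w) *\<^sub>C a"
      by (simp add: scaleC_diff_left)
    finally have eq: "?g v - ?g w = ?g w * ((v - w) *\<^sub>C a) * ?g v" .
    have "norm (?g v - ?g w) \<le> norm (?g w) * norm ((v - w) *\<^sub>C a) * norm (?g v)"
      unfolding eq by (meson norm_mult_ineq order_trans mult_right_mono norm_ge_zero)
    also have "\<dots> = dist v w * (norm (?g w) * norm a) * norm (?g v)"
      by (simp add: norm_scaleC dist_norm)
    also have "\<dots> \<le> dist v w * K * norm (?g v)"
      unfolding K_def by (intro mult_right_mono mult_left_mono) (auto simp: algebra_simps)
    finally have le: "norm (?g v - ?g w) \<le> dist v w * K * norm (?g v)" .
    have "dist v w * K \<le> 1 / 2"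
      using vw Kpos by (simp add: d_def field_simps)
    then have "norm (?g v - ?g w) \<le> 1 / 2 * norm (?g v)"
      using le by (meson mult_right_mono norm_ge_zero order_trans)
    then have "norm (?g v) \<le> 2 * norm (?g w)"
      using norm_triangle_ineq2[of "?g v" "?g w"] by simp
    then have "norm (?g v - ?g w) \<le> dist v w * K * (2 * norm (?g w))"
      using le by (smt (verit) Kpos mult_left_mono mult_nonneg_nonneg zero_le_dist)
    also have "\<dots> \<le> dist v w * (2 * K * (norm (?g w) + 1))"
      using Kpos by (simp add: algebra_simps)
    also have "\<dots> < e"
    proof -
      have "dist v w < e / (2 * K * (norm (?g w) + 1))" using vw by (simp add: d_def)
      moreover have "2 * K * (norm (?g w) + 1) > 0" using Kpos by (simp add: add_nonneg_pos)
      ultimately show ?thesis by (simp add: pos_less_divide_eq)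
    qed
    finally show "dist (?g v) (?g w) < e" by (simp add: dist_norm)
  qed (rule dpos)
qed

text \<open>Averaging over roots of unity turns the resolvent at \<open>u\<close> into the inverse of
  \<open>1 - (u a) ^ (2 ^ k)\<close>, so an estimate for the resolvents at \<open>u\<close> and \<open>s * u\<close> that is uniform on the
  circle passes to these inverses with the same constant, for every \<open>k\<close>.\<close>

lemma resolvent_power_close:
  fixes a :: "'a::cstar_algebra"
  assumes inv: "\<And>w. cmod w \<le> 1 \<Longrightarrow> invertible_elt (1 - w *\<^sub>C a)"
    and close: "\<And>u. cmod u = 1 \<Longrightarrow>
      norm (inverse_elt (1 - u *\<^sub>C a) - inverse_elt (1 - (s * u) *\<^sub>C a)) \<le> e"
    and s: "cmod s \<le> 1" and u: "cmod u = 1"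
  shows "invertible_elt (1 - (u *\<^sub>C a) ^ (2 ^ k))"
    and "invertible_elt (1 - ((s * u) *\<^sub>C a) ^ (2 ^ k))"
    and "norm (inverse_elt (1 - (u *\<^sub>C a) ^ (2 ^ k))
              - inverse_elt (1 - ((s * u) *\<^sub>C a) ^ (2 ^ k))) \<le> e"
proof -
  have "invertible_elt (1 - (u *\<^sub>C a) ^ (2 ^ k)) \<and>
        invertible_elt (1 - ((s * u) *\<^sub>C a) ^ (2 ^ k)) \<and>
        norm (inverse_elt (1 - (u *\<^sub>C a) ^ (2 ^ k))
              - inverse_elt (1 - ((s * u) *\<^sub>C a) ^ (2 ^ k))) \<le> e"
    using u
  proof (induction k arbitrary: u)
    case 0
    then show ?case using close[of u] inv[of u] inv[of "s * u"] s by (simp add: norm_mult)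
  next
    case (Suc k)
    \<comment> \<open>Rotating \<open>u\<close> by \<open>\<zeta>\<close> changes the sign of the power, so the induction hypothesis at \<open>u\<close> and at
      \<open>\<zeta> * u\<close> covers both summands of the partial fraction decomposition.\<close>
    define \<zeta> where "\<zeta> = cis (pi / 2 ^ k)"
    have \<zeta>: "\<zeta> ^ (2 ^ k) = -1" unfolding \<zeta>_def by (subst Complex.DeMoivre) simp
    have u': "cmod (\<zeta> * u) = 1" using Suc.prems by (simp add: \<zeta>_def norm_mult)
    define y where "y = (u *\<^sub>C a) ^ (2 ^ k)"
    define z where "z = ((s * u) *\<^sub>C a) ^ (2 ^ k)"
    have "((\<zeta> * u) *\<^sub>C a) ^ (2 ^ k) = - y" "((s * (\<zeta> * u)) *\<^sub>C a) ^ (2 ^ k) = - z"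
      by (simp_all add: y_def z_def scaleC_power power_mult_distrib \<zeta>)
    then have 1: "invertible_elt (1 + y)" "invertible_elt (1 + z)"
        "norm (inverse_elt (1 + y) - inverse_elt (1 + z)) \<le> e"
      using Suc.IH[OF u'] by auto
    have 2: "invertible_elt (1 - y)" "invertible_elt (1 - z)"
        "norm (inverse_elt (1 - y) - inverse_elt (1 - z)) \<le> e"
      using Suc.IH[OF Suc.prems] by (auto simp: y_def z_def)
    have sq: "(u *\<^sub>C a) ^ (2 ^ Suc k) = y * y" "((s * u) *\<^sub>C a) ^ (2 ^ Suc k) = z * z"
      by (simp_all add: y_def z_def power_add[symmetric] mult_2)
    have "inverse_elt (1 - y * y) - inverse_elt (1 - z * z)
        = (1/2) *\<^sub>R ((inverse_elt (1 - y) - inverse_elt (1 - z))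
                    + (inverse_elt (1 + y) - inverse_elt (1 + z)))"
      using 1 2 by (simp add: inverse_one_minus_square(2) algebra_simps)
    then have "norm (inverse_elt (1 - y * y) - inverse_elt (1 - z * z))
        \<le> (1/2) * (norm (inverse_elt (1 - y) - inverse_elt (1 - z))
                    + norm (inverse_elt (1 + y) - inverse_elt (1 + z)))"
      by (simp add: norm_triangle_ineq del: scaleR_add_right)
    then show ?case unfolding sq using 1 2 by (simp add: inverse_one_minus_square(1))
  qed
  then show "invertible_elt (1 - (u *\<^sub>C a) ^ (2 ^ k))"
    "invertible_elt (1 - ((s * u) *\<^sub>C a) ^ (2 ^ k))"
    "norm (inverse_elt (1 - (u *\<^sub>C a) ^ (2 ^ k))
              - inverse_elt (1 - ((s * u) *\<^sub>C a) ^ (2 ^ k))) \<le> e"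
    by auto
qed

text \<open>Rickart's elementary route to the spectral radius, without vector-valued function theory. Were
  the resolvent defined on the whole closed disc, it would be uniformly continuous there, so the
  resolvents at \<open>u\<close> and \<open>t * u\<close> would be uniformly close for some \<open>t < 1\<close>. After averaging, the
  inverses of \<open>1 - y\<close> and \<open>1 - z\<close> are equally close, where \<open>y = a ^ (2 ^ k)\<close> and
  \<open>z = t ^ (2 ^ k) * y\<close>. For large \<open>k\<close> the second inverse is nearly 1, hence so is the first, and
  \<open>y\<close> is small. But \<open>y\<close> has norm 1.\<close>

lemma not_invertible_on_disc:
  fixes a :: "'a::cstar_algebra"
  assumes sa: "self_adjoint a" and n1: "norm a = 1"
  shows "\<exists>w. cmod w \<le> 1 \<and> \<not> invertible_elt (1 - w *\<^sub>C a)"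
proof (rule ccontr)
  assume "\<not> ?thesis"
  then have inv: "\<And>w. cmod w \<le> 1 \<Longrightarrow> invertible_elt (1 - w *\<^sub>C a)" by auto
  let ?g = "\<lambda>w. inverse_elt (1 - w *\<^sub>C a)"
  \<comment> \<open>The constants \<open>1/8\<close> and, below, \<open>1/10\<close> are chosen such that \<open>norm (H - 1) < 1/4\<close>, which suffices
    as \<open>norm y \<le> 2 * norm (H - 1)\<close>.\<close>
  have "uniformly_continuous_on (cball 0 1) ?g"
    by (intro compact_uniformly_continuous continuous_on_resolvent) (auto simp: inv)
  then obtain d where d: "d > 0"
    "\<And>v w. v \<in> cball 0 1 \<Longrightarrow> w \<in> cball 0 1 \<Longrightarrow> dist v w < d \<Longrightarrow> dist (?g v) (?g w) < 1/8"
    unfolding uniformly_continuous_on_def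
    by (metis (no_types, lifting) zero_less_divide_1_iff zero_less_numeral)
  define t where "t = max (1/2) (1 - d/2)"
  have t: "0 < t" "t < 1" "1 - t < d" using d(1) by (auto simp: t_def)
  define s where "s = complex_of_real t"
  have s: "cmod s \<le> 1" using t by (simp add: s_def)
  have close: "norm (?g u - ?g (s * u)) \<le> 1/8" if "cmod u = 1" for u
  proof -
    have "u - s * u = complex_of_real (1 - t) * u" by (simp add: s_def algebra_simps)
    then have "dist u (s * u) = \<bar>1 - t\<bar>"
      using that by (simp add: dist_norm norm_mult del: of_real_diff)
    then have "dist (?g u) (?g (s * u)) < 1/8"
      using t s that by (intro d(2)) (auto simp: norm_mult)
    then show ?thesis by (simp add: dist_norm)
  qed
  obtain k0 where k0: "t ^ k0 < 1/10" using real_arch_pow_inv[of "1/10" t] t by auto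
  have "t ^ (2 ^ k0) \<le> t ^ k0" using t by (intro power_decreasing) auto
  then have tk: "t ^ (2 ^ k0) < 1/10" using k0 by simp
  define y where "y = a ^ (2 ^ k0)"
  have ny: "norm y = 1" using norm_power_two_power[OF sa] n1 by (simp add: y_def)
  define z where "z = (t ^ (2 ^ k0)) *\<^sub>R y"
  have nz: "norm z \<le> 1/10" using tk t by (simp add: z_def ny)
  have zeq: "((s * 1) *\<^sub>C a) ^ (2 ^ k0) = z"
    by (simp add: z_def y_def s_def scaleC_power scaleR_scaleC)
  have yeq: "(1 *\<^sub>C a) ^ (2 ^ k0) = y" by (simp add: y_def)
  note rpc = resolvent_power_close[of a s "1/8" 1 k0, OF inv close s, unfolded zeq yeq, simplified]
  define H where "H = inverse_elt (1 - y)"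
  define K where "K = inverse_elt (1 - z)"
  have HK: "norm (H - K) \<le> 1/8" using rpc(3) by (simp add: H_def K_def)
  have H: "(1 - y) * H = 1" unfolding H_def by (rule inverse_elt(1)[OF rpc(1)])
  have K: "(1 - z) * K = 1" unfolding K_def by (rule inverse_elt(1)[OF rpc(2)])
  have "K - 1 = z * K" using K by (simp add: algebra_simps)
  then have "norm (K - 1) \<le> norm z * norm K" using norm_mult_ineq by metis
  also have "\<dots> \<le> 1/10 * norm K" using nz by (rule mult_right_mono) simp
  finally have K1: "norm (K - 1) \<le> 1/10 * norm K" .
  then have "norm K \<le> 1 + 1/10 * norm K" using norm_triangle_ineq2[of K 1] by simp
  then have "norm (K - 1) \<le> 1/9" using K1 by simp
  then have H1: "norm (H - 1) < 1/4"
    using HK norm_triangle_ineq[of "H - K" "K - 1"] by simp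
  have "H - 1 = y * H" using H by (simp add: algebra_simps)
  then have "y = (H - 1) - y * (H - 1)" by (simp add: algebra_simps)
  then have "norm y \<le> norm (H - 1) + norm (y * (H - 1))" by (metis norm_triangle_ineq4)
  also have "\<dots> \<le> norm (H - 1) + norm (H - 1)" using norm_mult_ineq[of y "H - 1"] ny by simp
  finally show False using H1 ny by simp
qed

text \<open>The previous lemma, rescaled, yields a spectral value of modulus at least \<open>norm a\<close>. It is real
  because \<open>a\<close> is self-adjoint, and its modulus is at most \<open>norm a\<close> by the Neumann series.\<close>

lemma norm_attained_in_spectrum:
  fixes a :: "'a::cstar_algebra"
  assumes sa: "self_adjoint a"
  shows "\<exists>x. complex_of_real x \<in> cspectrum a \<and> \<bar>x\<bar> = norm a"
proof (cases "a = 0")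
  case True
  have "\<not> invertible_elt (0::'a)" by (auto simp: invertible_elt_def)
  then show ?thesis using True by (auto simp: cspectrum_iff intro!: exI[of _ 0])
next
  case False
  define b where "b = (1 / norm a) *\<^sub>R a"
  have "self_adjoint b" "norm b = 1" using False sa by (simp_all add: b_def self_adjoint_simps)
  then obtain w where w: "cmod w \<le> 1" "\<not> invertible_elt (1 - w *\<^sub>C b)"
    using not_invertible_on_disc by blast
  have w0: "w \<noteq> 0" using w(2) by (auto simp: invertible_elt_def)
  let ?z = "complex_of_real (norm a) / w"
  have "w *\<^sub>C b = (w / complex_of_real (norm a)) *\<^sub>C a"
    by (simp add: b_def scaleR_scaleC scaleC_scaleC)
  then have "1 - w *\<^sub>C b = (- (1 / ?z)) *\<^sub>C (a - ?z *\<^sub>C 1)"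
    using w0 False by (simp add: scaleC_diff_right scaleC_scaleC)
  then have z: "?z \<in> cspectrum a"
    using w w0 False invertible_elt_scaleC[of "- (1 / ?z)" "a - ?z *\<^sub>C 1"]
    by (auto simp: cspectrum_iff)
  then have "?z \<in> \<real>" by (rule cspectrum_self_adjoint_real[OF sa])
  then obtain x where x: "?z = complex_of_real x" by (auto elim: Reals_cases)
  have "norm a \<le> cmod ?z" using w w0 by (simp add: norm_divide field_simps mult_left_le)
  moreover have "cmod ?z \<le> norm a" by (rule cspectrum_norm_le[OF z])
  ultimately show ?thesis using z x by auto
qed

section \<open>Polynomials in a self-adjoint element\<close>

lemma poly_at_0 [simp]: "poly_at 0 (a::'a::cstar_algebra) = 0"
  by (simp add: poly_at_def)

lemma poly_at_pCons [simp]: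
  "poly_at (pCons c p) (a::'a::cstar_algebra) = c *\<^sub>R 1 + a * poly_at p a"
proof (cases "p = 0")
  case False
  then show ?thesis
    by (simp add: poly_at_def sum.atMost_Suc_shift sum_distrib_left del: sum.atMost_Suc)
qed (simp add: poly_at_def)

lemma poly_at_add: "poly_at (p + q) (a::'a::cstar_algebra) = poly_at p a + poly_at q a"
  by (induction p q rule: poly_induct2) (simp_all add: algebra_simps)

lemma poly_at_smult: "poly_at (smult c p) (a::'a::cstar_algebra) = c *\<^sub>R poly_at p a"
  by (induction p) (simp_all add: algebra_simps)

lemma poly_at_diff: "poly_at (p - q) (a::'a::cstar_algebra) = poly_at p a - poly_at q a"
  using poly_at_add[of p "-q" a] poly_at_smult[of "-1" q a] by simp

lemma poly_at_mult: "poly_at (p * q) (a::'a::cstar_algebra) = poly_at p a * poly_at q a"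
  by (induction p) (simp_all add: poly_at_add poly_at_smult algebra_simps)

lemma poly_at_commute:
  fixes a b :: "'a::cstar_algebra"
  assumes "a * b = b * a"
  shows "poly_at p a * b = b * poly_at p a"
proof (induction p)
  case (pCons c p)
  have "a * poly_at p a * b = a * b * poly_at p a" by (simp add: mult.assoc pCons)
  then show ?case by (simp add: algebra_simps assms)
qed simp

lemma self_adjoint_poly_at:
  assumes "self_adjoint a"
  shows "self_adjoint (poly_at p a)"
proof (induction p)
  case (pCons c p)
  then show ?case
    using assms poly_at_commute[of a a p]
    by (simp add: self_adjoint_def star_add star_scaleR star_mult)
qed (simp add: self_adjoint_simps)

text \<open>Factoring a real polynomial into linear factors needs complex coefficients. The Horner form
  makes the recursion over the polynomial immediate.\<close>

definition cpoly_at :: "complex poly \<Rightarrow> 'a::cstar_algebra \<Rightarrow> 'a" where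
  "cpoly_at p a = fold_coeffs (\<lambda>c y. c *\<^sub>C 1 + a * y) p 0"

lemma cpoly_at_0 [simp]: "cpoly_at 0 a = 0"
  by (simp add: cpoly_at_def)

lemma cpoly_at_pCons [simp]: "cpoly_at (pCons c p) a = c *\<^sub>C 1 + a * cpoly_at p a"
  by (cases "c = 0 \<and> p = 0") (auto simp: cpoly_at_def)

lemma cpoly_at_add: "cpoly_at (p + q) a = cpoly_at p a + cpoly_at q a"
  by (induction p q rule: poly_induct2) (simp_all add: scaleC_add_left algebra_simps)

lemma cpoly_at_smult: "cpoly_at (smult c p) a = c *\<^sub>C cpoly_at p a"
  by (induction p) (simp_all add: scaleC_add_right scaleC_scaleC mult_scaleC_right)

lemma cpoly_at_of_real: "cpoly_at (map_poly complex_of_real p) a = poly_at p a"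
  by (induction p) (simp_all add: map_poly_pCons scaleR_scaleC)

lemma poly_map_poly_of_real:
  "poly (map_poly complex_of_real p) (complex_of_real x) = complex_of_real (poly p x)"
  by (induction p) (simp_all add: map_poly_pCons)

text \<open>The half of the spectral mapping theorem that is needed: \<open>p\<close> splits into linear factors, each of
  which is invertible at \<open>a\<close>.\<close>

lemma invertible_cpoly_at:
  fixes a :: "'a::cstar_algebra"
  assumes "p \<noteq> 0" "\<And>z. z \<in> cspectrum a \<Longrightarrow> poly p z \<noteq> 0"
  shows "invertible_elt (cpoly_at p a)"
  using assms
proof (induction p rule: poly_root_induct[where P = "\<lambda>_. True"])
  case (no_roots p)
  then have "constant (poly p)" using fundamental_theorem_of_algebra by blast
  then obtain c where c: "p = [:c:]" by (auto simp: constant_degree elim: degree_eq_zeroE)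
  then have "c \<noteq> 0" using no_roots by auto
  then have "invertible_elt (c *\<^sub>C (1::'a))"
    by (intro invertible_elt_scaleC inverse_elt_eqI[of 1 1]) auto
  then show ?case by (simp add: c)
next
  case (root w p)
  have "cpoly_at ([:w, -1:] * p) a = - (a - w *\<^sub>C 1) * cpoly_at p a"
    using cpoly_at_smult[of "-1" p a]
    by (simp add: cpoly_at_add cpoly_at_smult algebra_simps mult_scaleC_left)
  moreover have "w \<notin> cspectrum a" using root.prems(2)[of w] by auto
  moreover have "invertible_elt (cpoly_at p a)"
    by (rule root.IH) (use root.prems in \<open>auto simp: poly_mult\<close>)
  ultimately show ?case
    by (simp only: cspectrum_iff) (metis invertible_elt_minus invertible_elt_mult)
qed simp

text \<open>The polynomial calculus is isometric for the supremum norm on the spectrum: \<open>poly_at p a\<close> is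
  self-adjoint, so its norm is the modulus of one of its spectral values, and such a value is
  \<open>poly p x\<close> for some \<open>x\<close> in the spectrum of \<open>a\<close>.\<close>

lemma norm_poly_at_attained:
  fixes a :: "'a::cstar_algebra"
  assumes sa: "self_adjoint a"
  shows "\<exists>x. complex_of_real x \<in> cspectrum a \<and> norm (poly_at p a) = \<bar>poly p x\<bar>"
proof -
  obtain y where y: "complex_of_real y \<in> cspectrum (poly_at p a)" "\<bar>y\<bar> = norm (poly_at p a)"
    using norm_attained_in_spectrum[OF self_adjoint_poly_at[OF sa]] by blast
  let ?q = "map_poly complex_of_real p + [:- complex_of_real y:]"
  have "cpoly_at ?q a = poly_at p a - complex_of_real y *\<^sub>C 1"
    by (simp add: cpoly_at_add cpoly_at_of_real)
  then have ninv: "\<not> invertible_elt (cpoly_at ?q a)" using y(1) by (simp add: cspectrum_iff)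
  obtain z where z: "z \<in> cspectrum a" "poly ?q z = 0"
  \<comment> \<open>If \<open>p\<close> is constant with value \<open>y\<close>, any point of the nonempty spectrum will do.\<close>
  proof (cases "?q = 0")
    case True
    then show ?thesis using that norm_attained_in_spectrum[OF sa] by fastforce
  next
    case False
    then show ?thesis using that invertible_cpoly_at[OF False] ninv by blast
  qed
  obtain x where x: "z = complex_of_real x"
    using cspectrum_self_adjoint_real[OF sa z(1)] by (auto elim: Reals_cases)
  have "complex_of_real (poly p x) = complex_of_real y"
    using z(2) by (simp add: x poly_map_poly_of_real)
  then have "poly p x = y" by (simp only: of_real_eq_iff)
  then show ?thesis using z(1) x y(2) by auto
qed

section \<open>Continuous functional calculus\<close>

abbreviation real_spectrum :: "'a::cstar_algebra \<Rightarrow> real set" where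
  "real_spectrum a \<equiv> {x. complex_of_real x \<in> cspectrum a}"

lemma norm_poly_at_le:
  assumes "self_adjoint a" "\<And>x. x \<in> real_spectrum a \<Longrightarrow> \<bar>poly p x\<bar> \<le> c"
  shows "norm (poly_at p a) \<le> c"
  using norm_poly_at_attained[OF assms(1), of p] assms(2) by auto

text \<open>As the polynomial calculus is isometric, uniformly convergent polynomials have convergent values
  at \<open>a\<close>, and two sequences with the same uniform limit have the same limit at \<open>a\<close>. So one
  approximating sequence is enough for the definite description to be well defined.\<close>

lemma cfc_tendsto:
  fixes a :: "'a::cstar_algebra"
  assumes sa: "self_adjoint a"
    and p: "uniform_limit (real_spectrum a) (\<lambda>n. poly (p n)) f sequentially"
  shows "(\<lambda>n. poly_at (p n) a) \<longlonglongrightarrow> cfc f a"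
proof -
  have close: "\<exists>N. \<forall>m\<ge>N. \<forall>n\<ge>N. norm (poly_at (q m) a - poly_at (p n) a) \<le> e"
    if q: "uniform_limit (real_spectrum a) (\<lambda>n. poly (q n)) f sequentially" and e: "e > 0"
    for q :: "nat \<Rightarrow> real poly" and e
  proof -
    obtain M where M: "\<And>m x. m \<ge> M \<Longrightarrow> x \<in> real_spectrum a \<Longrightarrow> dist (poly (q m) x) (f x) < e/2"
      using q e unfolding uniform_limit_sequentially_iff by (metis half_gt_zero)
    obtain N where N: "\<And>n x. n \<ge> N \<Longrightarrow> x \<in> real_spectrum a \<Longrightarrow> dist (poly (p n) x) (f x) < e/2"
      using p e unfolding uniform_limit_sequentially_iff by (metis half_gt_zero)
    have "norm (poly_at (q m) a - poly_at (p n) a) \<le> e" if "m \<ge> max M N" "n \<ge> max M N" for m n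
      unfolding poly_at_diff[symmetric]
    proof (rule norm_poly_at_le[OF sa])
      fix x assume x: "x \<in> real_spectrum a"
      show "\<bar>poly (q m - p n) x\<bar> \<le> e"
        using M[of m x] N[of n x] that x by (simp add: dist_real_def abs_if field_simps split: if_splits)
    qed
    then show ?thesis by blast
  qed
  have "Cauchy (\<lambda>n. poly_at (p n) a)"
  proof (rule metric_CauchyI)
    fix e :: real assume "0 < e"
    then obtain N where "\<forall>m\<ge>N. \<forall>n\<ge>N. norm (poly_at (p m) a - poly_at (p n) a) \<le> e/2"
      using close[OF p, of "e/2"] by auto
    then show "\<exists>N. \<forall>m\<ge>N. \<forall>n\<ge>N. dist (poly_at (p m) a) (poly_at (p n) a) < e"
      using \<open>0 < e\<close> by (intro exI[of _ N]) (force simp: dist_norm)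
  qed
  then obtain b where b: "(\<lambda>n. poly_at (p n) a) \<longlonglongrightarrow> b"
    by (auto simp: Cauchy_convergent_iff convergent_def)
  have all: "(\<lambda>n. poly_at (q n) a) \<longlonglongrightarrow> b"
    if q: "uniform_limit (real_spectrum a) (\<lambda>n. poly (q n)) f sequentially" for q
  proof -
    have diff: "(\<lambda>n. poly_at (q n) a - poly_at (p n) a) \<longlonglongrightarrow> 0"
    proof (rule LIMSEQ_I)
      fix e :: real assume "0 < e"
      then obtain N where "\<forall>m\<ge>N. \<forall>n\<ge>N. norm (poly_at (q m) a - poly_at (p n) a) \<le> e/2"
        using close[OF q, of "e/2"] by auto
      then show "\<exists>N. \<forall>n\<ge>N. norm (poly_at (q n) a - poly_at (p n) a - 0) < e"
        using \<open>0 < e\<close> by (intro exI[of _ N]) force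
    qed
    show ?thesis using tendsto_add[OF diff b] by simp
  qed
  have "cfc f a = b"
    unfolding cfc_def
    by (rule the_equality) (use all p b LIMSEQ_unique in blast)+
  then show ?thesis using b by simp
qed

lemma real_polynomial_function_poly:
  fixes g :: "real \<Rightarrow> real"
  assumes "real_polynomial_function g"
  shows "\<exists>p. g = poly p"
proof -
  obtain c n where g: "g = (\<lambda>x. \<Sum>i\<le>n. c i * x ^ i)"
    using assms by (auto simp: real_polynomial_function_iff_sum)
  have "poly (\<Sum>i\<le>n. monom (c i) i) x = g x" for x
    by (simp add: g poly_sum poly_monom)
  then show ?thesis by (intro exI[of _ "\<Sum>i\<le>n. monom (c i) i"]) (simp add: fun_eq_iff)
qed

lemma uniform_polynomial_approximation:
  fixes f :: "real \<Rightarrow> real"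
  assumes "compact S" "continuous_on S f"
  shows "\<exists>p. uniform_limit S (\<lambda>n. poly (p n)) f sequentially"
proof -
  have "\<exists>p. \<forall>x\<in>S. \<bar>f x - poly p x\<bar> < 1 / real (Suc n)" for n
    using Stone_Weierstrass_real_polynomial_function[OF assms, of "1 / real (Suc n)"]
      real_polynomial_function_poly by (metis of_nat_0_less_iff zero_less_Suc zero_less_divide_1_iff)
  then obtain p where p: "\<And>n x. x \<in> S \<Longrightarrow> \<bar>f x - poly (p n) x\<bar> < 1 / real (Suc n)"
    by metis
  have "uniform_limit S (\<lambda>n. poly (p n)) f sequentially"
  proof (rule uniform_limitI)
    fix e :: real assume "e > 0"
    then obtain N where N: "1 / real (Suc N) < e" using nat_approx_posE by blast
    show "\<forall>\<^sub>F n in sequentially. \<forall>x\<in>S. dist (poly (p n) x) (f x) < e"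
      unfolding eventually_sequentially
    proof (intro exI allI impI ballI)
      fix n x assume "N \<le> n" "x \<in> S"
      then have "\<bar>f x - poly (p n) x\<bar> < 1 / real (Suc N)"
        using p[of x n] by (smt (verit) Suc_le_mono frac_le of_nat_0_less_iff of_nat_mono zero_less_Suc)
      then show "dist (poly (p n) x) (f x) < e" using N by (simp add: dist_real_def)
    qed
  qed
  then show ?thesis by blast
qed

lemma cstar_positive_self_adjoint: "cstar_positive a \<Longrightarrow> self_adjoint a"
  by (simp add: cstar_positive_def)

lemma real_spectrum_positive:
  assumes "cstar_positive a"
  shows "real_spectrum a \<subseteq> {0..norm a}"
  using assms cspectrum_norm_le by (fastforce simp: cstar_positive_def)

lemma cpow_approx:
  fixes a :: "'a::cstar_algebra"
  assumes a: "cstar_positive a" and s: "0 < s"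
  obtains p where "uniform_limit (real_spectrum a) (\<lambda>n. poly (p n)) (\<lambda>x. x powr s) sequentially"
    and "(\<lambda>n. poly_at (p n) a) \<longlonglongrightarrow> cpow a s"
proof -
  have "continuous_on {0..norm a} (\<lambda>x. x powr s)"
    using s by (intro continuous_on_powr' continuous_intros) auto
  then obtain p where "uniform_limit {0..norm a} (\<lambda>n. poly (p n)) (\<lambda>x. x powr s) sequentially"
    using uniform_polynomial_approximation by blast
  then have p: "uniform_limit (real_spectrum a) (\<lambda>n. poly (p n)) (\<lambda>x. x powr s) sequentially"
    using real_spectrum_positive[OF a] by (rule uniform_limit_on_subset)
  show ?thesis
    using that[OF p] cfc_tendsto[OF cstar_positive_self_adjoint[OF a] p] s by (simp add: cpow_def)
qed

lemma cpow_0 [simp]: "cpow a 0 = 1"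
  by (simp add: cpow_def)

lemma cpow_1:
  assumes a: "cstar_positive a"
  shows "cpow a 1 = a"
proof -
  have "uniform_limit (real_spectrum a) (\<lambda>n. poly [:0, 1:]) (\<lambda>x. x powr 1) sequentially"
    using real_spectrum_positive[OF a]
    by (intro uniform_limitI eventually_sequentiallyI ballI) (auto simp: subset_iff)
  then have "(\<lambda>n::nat. poly_at [:0, 1:] a) \<longlonglongrightarrow> cpow a 1"
    using cfc_tendsto[OF cstar_positive_self_adjoint[OF a], of "\<lambda>_. [:0, 1:]" "\<lambda>x. x powr 1"]
    by (simp add: cpow_def)
  then show ?thesis by (simp add: LIMSEQ_const_iff)
qed

lemma cpow_add:
  fixes a :: "'a::cstar_algebra"
  assumes a: "cstar_positive a" and st: "0 \<le> s" "0 \<le> t"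
  shows "cpow a (s + t) = cpow a s * cpow a t"
proof (cases "s = 0 \<or> t = 0")
  case False
  then have pos: "0 < s" "0 < t" using st by auto
  obtain p where p: "uniform_limit (real_spectrum a) (\<lambda>n. poly (p n)) (\<lambda>x. x powr s) sequentially"
    "(\<lambda>n. poly_at (p n) a) \<longlonglongrightarrow> cpow a s"
    using cpow_approx[OF a pos(1)] .
  obtain q where q: "uniform_limit (real_spectrum a) (\<lambda>n. poly (q n)) (\<lambda>x. x powr t) sequentially"
    "(\<lambda>n. poly_at (q n) a) \<longlonglongrightarrow> cpow a t"
    using cpow_approx[OF a pos(2)] .
  have bdd: "bounded ((\<lambda>x. x powr u) ` real_spectrum a)" if "u > 0" for u
    unfolding bounded_iff
  proof (intro exI ballI)
    fix y assume "y \<in> (\<lambda>x. x powr u) ` real_spectrum a"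
    then obtain x where "y = x powr u" "0 \<le> x" "x \<le> norm a"
      using real_spectrum_positive[OF a] by auto
    then show "norm y \<le> norm a powr u" using that by (simp add: powr_mono2)
  qed
  \<comment> \<open>Products of uniformly convergent sequences converge uniformly because the limits are bounded.\<close>
  have "uniform_limit (real_spectrum a) (\<lambda>n. poly (p n * q n)) (\<lambda>x. x powr (s + t)) sequentially"
    using uniform_lim_mult[OF p(1) q(1) bdd bdd] pos by (simp add: powr_add poly_mult[abs_def])
  then have "(\<lambda>n. poly_at (p n * q n) a) \<longlonglongrightarrow> cpow a (s + t)"
    using cfc_tendsto[OF cstar_positive_self_adjoint[OF a], of "\<lambda>n. p n * q n"] pos
    by (simp add: cpow_def)
  moreover have "(\<lambda>n. poly_at (p n * q n) a) \<longlonglongrightarrow> cpow a s * cpow a t"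
    unfolding poly_at_mult by (intro tendsto_mult p q)
  ultimately show ?thesis by (rule LIMSEQ_unique)
qed auto

lemma self_adjoint_cpow:
  fixes a :: "'a::cstar_algebra"
  assumes a: "cstar_positive a" and s: "0 \<le> s"
  shows "self_adjoint (cpow a s)"
proof (cases "s = 0")
  case False
  then obtain p where p: "(\<lambda>n. poly_at (p n) a) \<longlonglongrightarrow> cpow a s"
    using cpow_approx[OF a, of s] s by auto
  have "(\<lambda>n. (poly_at (p n) a)\<^sup>\<star>) \<longlonglongrightarrow> (cpow a s)\<^sup>\<star>" by (rule tendsto_star[OF p])
  moreover have "(poly_at (p n) a)\<^sup>\<star> = poly_at (p n) a" for n
    using self_adjoint_poly_at[OF cstar_positive_self_adjoint[OF a]] by (simp add: self_adjoint_def)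
  ultimately show ?thesis using p LIMSEQ_unique unfolding self_adjoint_def by auto
qed (simp add: self_adjoint_simps)

lemma cpow_commute:
  fixes a b :: "'a::cstar_algebra"
  assumes a: "cstar_positive a" and s: "0 \<le> s" and ab: "a * b = b * a"
  shows "cpow a s * b = b * cpow a s"
proof (cases "s = 0")
  case False
  then obtain p where p: "(\<lambda>n. poly_at (p n) a) \<longlonglongrightarrow> cpow a s"
    using cpow_approx[OF a, of s] s by auto
  have "(\<lambda>n. poly_at (p n) a * b) \<longlonglongrightarrow> cpow a s * b"
    by (intro tendsto_mult p tendsto_const)
  moreover have "(\<lambda>n. poly_at (p n) a * b) \<longlonglongrightarrow> b * cpow a s"
    unfolding poly_at_commute[OF ab] by (intro tendsto_mult p tendsto_const)
  ultimately show ?thesis by (rule LIMSEQ_unique)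
qed simp

lemma norm_cpow_le:
  fixes a :: "'a::cstar_algebra"
  assumes a: "cstar_positive a" and s: "0 \<le> s" "s \<le> 1"
  shows "norm (cpow a s) \<le> 1 + norm a"
proof (cases "s = 0")
  case False
  then obtain p where p: "uniform_limit (real_spectrum a) (\<lambda>n. poly (p n)) (\<lambda>x. x powr s) sequentially"
    "(\<lambda>n. poly_at (p n) a) \<longlonglongrightarrow> cpow a s"
    using cpow_approx[OF a, of s] s by auto
  have powr: "x powr s \<le> 1 + norm a" if "x \<in> real_spectrum a" for x
  proof -
    have "0 \<le> x" "x \<le> norm a" using that real_spectrum_positive[OF a] by auto
    then have "x powr s \<le> (1 + norm a) powr s" using s by (intro powr_mono2) auto
    also have "\<dots> \<le> (1 + norm a) powr 1" using s by (intro powr_mono) auto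
    finally show ?thesis by simp
  qed
  show ?thesis
  proof (rule field_le_epsilon)
    fix e :: real assume "e > 0"
    then have "\<forall>\<^sub>F n in sequentially. \<forall>x\<in>real_spectrum a. dist (poly (p n) x) (x powr s) < e"
      using p(1) by (rule uniform_limitD[rotated])
    then have "\<forall>\<^sub>F n in sequentially. norm (poly_at (p n) a) \<le> 1 + norm a + e"
    proof (rule eventually_mono)
      fix n assume n: "\<forall>x\<in>real_spectrum a. dist (poly (p n) x) (x powr s) < e"
      show "norm (poly_at (p n) a) \<le> 1 + norm a + e"
      proof (rule norm_poly_at_le[OF cstar_positive_self_adjoint[OF a]])
        fix x assume x: "x \<in> real_spectrum a"
        have "\<bar>poly (p n) x - x powr s\<bar> < e" using n x by (simp add: dist_real_def)
        then show "\<bar>poly (p n) x\<bar> \<le> 1 + norm a + e"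
          using powr[OF x] powr_ge_zero[of x s] by linarith
      qed
    qed
    then show "norm (cpow a s) \<le> 1 + norm a + e"
      by (intro tendsto_upperbound[OF tendsto_norm[OF p(2)]]) auto
  qed
qed simp

section \<open>The cone of positive elements\<close>

text \<open>This lemma and the next one describe positivity through the norm alone: the spectrum lies in the
  disc of radius \<open>t\<close> around \<open>t\<close>, which meets the real line in nonnegative numbers only.\<close>

lemma cstar_positiveI_norm:
  fixes a :: "'a::cstar_algebra"
  assumes sa: "self_adjoint a" and n: "norm (t *\<^sub>R 1 - a) \<le> t"
  shows "cstar_positive a"
  unfolding cstar_positive_def
proof (intro conjI ballI sa)
  fix z assume z: "z \<in> cspectrum a"
  show real: "z \<in> \<real>" by (rule cspectrum_self_adjoint_real[OF sa z])
  have "complex_of_real t - z \<in> cspectrum (t *\<^sub>R 1 - a)"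
    using z cspectrum_reflect[of "complex_of_real t - z" "complex_of_real t" a]
    by (simp add: scaleR_scaleC)
  then have "cmod (complex_of_real t - z) \<le> t" using cspectrum_norm_le n order_trans by blast
  then show "0 \<le> Re z" using abs_Re_le_cmod[of "complex_of_real t - z"] by simp
qed

lemma cstar_positiveD_norm:
  fixes a :: "'a::cstar_algebra"
  assumes a: "cstar_positive a" and t: "norm a \<le> t"
  shows "norm (t *\<^sub>R 1 - a) \<le> t"
proof -
  have "self_adjoint (t *\<^sub>R 1 - a)"
    using a by (simp add: self_adjoint_simps cstar_positive_def)
  then obtain x where x: "complex_of_real x \<in> cspectrum (t *\<^sub>R 1 - a)"
      "\<bar>x\<bar> = norm (t *\<^sub>R 1 - a)"
    using norm_attained_in_spectrum by blast
  then have "complex_of_real t - complex_of_real x \<in> cspectrum a"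
    using cspectrum_reflect[of "complex_of_real x" "complex_of_real t" a]
    by (simp add: scaleR_scaleC)
  then have "t - x \<in> real_spectrum a" by simp
  then have "t - x \<in> {0..norm a}" using real_spectrum_positive[OF a] by blast
  then have "0 \<le> t - x" "t - x \<le> norm a" by simp_all
  then show ?thesis using t x(2) by linarith
qed

lemma cstar_positive_add:
  fixes a b :: "'a::cstar_algebra"
  assumes a: "cstar_positive a" and b: "cstar_positive b"
  shows "cstar_positive (a + b)"
proof (rule cstar_positiveI_norm)
  show "self_adjoint (a + b)" using assms by (simp add: self_adjoint_simps cstar_positive_def)
  have "(norm a + norm b) *\<^sub>R 1 - (a + b) = (norm a *\<^sub>R 1 - a) + (norm b *\<^sub>R 1 - b)"
    by (simp add: algebra_simps)
  then show "norm ((norm a + norm b) *\<^sub>R 1 - (a + b)) \<le> norm a + norm b"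
    using cstar_positiveD_norm[OF a order_refl] cstar_positiveD_norm[OF b order_refl]
    by (metis add_mono norm_triangle_le)
qed

lemma cstar_positive_scaleR:
  fixes a :: "'a::cstar_algebra"
  assumes a: "cstar_positive a" and r: "0 \<le> r"
  shows "cstar_positive (r *\<^sub>R a)"
proof (rule cstar_positiveI_norm)
  show "self_adjoint (r *\<^sub>R a)" using a by (simp add: self_adjoint_simps cstar_positive_def)
  have "(r * norm a) *\<^sub>R 1 - r *\<^sub>R a = r *\<^sub>R (norm a *\<^sub>R 1 - a)"
    by (simp add: algebra_simps)
  then show "norm ((r * norm a) *\<^sub>R 1 - r *\<^sub>R a) \<le> r * norm a"
    using cstar_positiveD_norm[OF a order_refl] r by (simp add: mult_left_mono)
qed

lemma cstar_positive_norm_plus: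
  fixes a :: "'a::cstar_algebra"
  assumes "self_adjoint a" "norm a \<le> t"
  shows "cstar_positive (a + t *\<^sub>R 1)"
  by (rule cstar_positiveI_norm[where t = t]) (use assms in \<open>simp_all add: self_adjoint_simps\<close>)

lemma cstar_positive_LIMSEQ:
  fixes f :: "nat \<Rightarrow> 'a::cstar_algebra"
  assumes pos: "\<And>n. cstar_positive (f n)" and lim: "f \<longlonglongrightarrow> a"
  shows "cstar_positive a"
proof -
  have "Bseq f" using lim convergent_imp_Bseq convergentI by blast
  then obtain t where t: "\<And>n. norm (f n) \<le> t" unfolding Bseq_def by blast
  show ?thesis
  proof (rule cstar_positiveI_norm)
    have "(\<lambda>n. (f n)\<^sup>\<star>) \<longlonglongrightarrow> a\<^sup>\<star>" by (rule tendsto_star[OF lim])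
    moreover have "(f n)\<^sup>\<star> = f n" for n
      using pos[of n] by (simp add: cstar_positive_def self_adjoint_def)
    ultimately show "self_adjoint a"
      using lim LIMSEQ_unique unfolding self_adjoint_def by auto
    have "(\<lambda>n. norm (t *\<^sub>R 1 - f n)) \<longlonglongrightarrow> norm (t *\<^sub>R 1 - a)"
      by (intro tendsto_intros lim)
    then show "norm (t *\<^sub>R 1 - a) \<le> t"
      by (rule LIMSEQ_le_const2) (use cstar_positiveD_norm[OF pos t] in blast)
  qed
qed

text \<open>For \<open>r > 0\<close>, the element \<open>a\<^sup>2 + r\<close> factors into \<open>a \<pm> i \<surd>r\<close>, and both factors are invertible
  because the spectrum of \<open>a\<close> is real.\<close>

lemma cstar_positive_square:
  fixes a :: "'a::cstar_algebra"
  assumes sa: "self_adjoint a"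
  shows "cstar_positive (a * a)"
  unfolding cstar_positive_def
proof (intro conjI ballI)
  show sa2: "self_adjoint (a * a)" using sa by (simp add: self_adjoint_def star_mult)
  fix z assume z: "z \<in> cspectrum (a * a)"
  show zr: "z \<in> \<real>" by (rule cspectrum_self_adjoint_real[OF sa2 z])
  show "0 \<le> Re z"
  proof (rule ccontr)
    assume neg: "\<not> 0 \<le> Re z"
    define w where "w = \<i> * complex_of_real (sqrt (- Re z))"
    have "Im w \<noteq> 0" using neg by (simp add: w_def)
    then have "w \<notin> \<real>" "- w \<notin> \<real>" by (auto simp: complex_is_Real_iff)
    then have "w \<notin> cspectrum a" "- w \<notin> cspectrum a"
      using cspectrum_self_adjoint_real[OF sa] by blast+
    then have inv: "invertible_elt ((a - w *\<^sub>C 1) * (a + w *\<^sub>C 1))"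
      by (intro invertible_elt_mult) (simp_all add: cspectrum_iff)
    have "w * w = z"
      using neg zr by (simp add: w_def complex_eq_iff complex_is_Real_iff)
    then have "(a - w *\<^sub>C 1) * (a + w *\<^sub>C 1) = a * a - z *\<^sub>C 1"
      by (simp add: algebra_simps mult_scaleC_left mult_scaleC_right scaleC_scaleC
          scaleC_diff_right)
    then show False using inv z by (simp add: cspectrum_iff)
  qed
qed

text \<open>The square roots of \<open>a\<close> and \<open>b\<close> commute, so \<open>a * b\<close> is the square of the self-adjoint product of
  these roots.\<close>

lemma cstar_positive_mult:
  fixes a b :: "'a::cstar_algebra"
  assumes a: "cstar_positive a" and b: "cstar_positive b" and ab: "a * b = b * a"
  shows "cstar_positive (a * b)"
proof -
  let ?p = "cpow a (1/2)" and ?q = "cpow b (1/2)"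
  have pp: "?p * ?p = a" using cpow_add[OF a, of "1/2" "1/2"] cpow_1[OF a] by simp
  have qq: "?q * ?q = b" using cpow_add[OF b, of "1/2" "1/2"] cpow_1[OF b] by simp
  have "?p * b = b * ?p" by (rule cpow_commute[OF a _ ab]) simp
  then have pq: "?q * ?p = ?p * ?q" using cpow_commute[OF b, of "1/2" ?p] by simp
  have "self_adjoint (?p * ?q)"
    using self_adjoint_cpow[OF a, of "1/2"] self_adjoint_cpow[OF b, of "1/2"] pq
    by (simp add: self_adjoint_def star_mult)
  then have "cstar_positive (?p * ?q * (?p * ?q))" by (rule cstar_positive_square)
  moreover have "?p * ?q * (?p * ?q) = ?p * (?q * ?p) * ?q" by (simp add: mult.assoc)
  moreover have "\<dots> = (?p * ?p) * (?q * ?q)" unfolding pq by (simp add: mult.assoc)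
  ultimately show ?thesis by (simp add: pp qq)
qed

lemma self_adjoint_cRe: "self_adjoint (cRe x)"
  by (simp add: cRe_def self_adjoint_def star_scaleR star_add star_star add.commute)

text \<open>Up to a factor, this is the sum of the squares of the real and the imaginary part of \<open>x\<close>. For a
  tracial map, or for a normal \<open>x\<close>, it replaces the deeper fact that \<open>x\<^sup>\<star> * x\<close> alone is positive.\<close>

lemma cstar_positive_symmetrized_square:
  fixes x :: "'a::cstar_algebra"
  shows "cstar_positive (x\<^sup>\<star> * x + x * x\<^sup>\<star>)"
proof -
  define h where "h = x + x\<^sup>\<star>"
  define k where "k = \<i> *\<^sub>C (x - x\<^sup>\<star>)"
  have "self_adjoint h" "self_adjoint k"
    by (simp_all add: h_def k_def self_adjoint_def star_add star_diff star_star star_scaleC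
        add.commute scaleC_diff_right)
  then have "cstar_positive ((1/2) *\<^sub>R (h * h + k * k))"
    by (intro cstar_positive_scaleR cstar_positive_add cstar_positive_square) auto
  moreover have "h * h + k * k = 2 *\<^sub>R (x\<^sup>\<star> * x + x * x\<^sup>\<star>)"
    by (simp add: h_def k_def mult_scaleC_left mult_scaleC_right scaleC_scaleC
        scaleC_diff_right algebra_simps scaleR_2)
  ultimately show ?thesis by simp
qed

text \<open>The inverse \<open>c\<close> is self-adjoint and equals \<open>c\<^sup>2 * a\<close>, a product of commuting positive elements.\<close>

lemma cstar_positive_inverse_elt:
  fixes a :: "'a::cstar_algebra"
  assumes a: "cstar_positive a" and inv: "invertible_elt a"
  shows "cstar_positive (inverse_elt a)"
proof -
  let ?c = "inverse_elt a"
  note c = inverse_elt[OF inv]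
  have "a\<^sup>\<star> = a" using a by (simp add: cstar_positive_def self_adjoint_def)
  then have "a * ?c\<^sup>\<star> = 1" "?c\<^sup>\<star> * a = 1"
    using arg_cong[OF c(1), of star] arg_cong[OF c(2), of star] by (simp_all add: star_mult)
  then have "self_adjoint ?c" using inverse_elt_eqI(2)[of a "?c\<^sup>\<star>"] by (simp add: self_adjoint_def)
  then have "cstar_positive (?c * ?c)" by (rule cstar_positive_square)
  then have "cstar_positive (?c * ?c * a)"
    by (rule cstar_positive_mult[OF _ a])
      (simp add: mult.assoc c, simp add: mult.assoc[symmetric] c)
  then show ?thesis by (simp add: mult.assoc c)
qed

lemma invertible_elt_positive_plus:
  fixes a :: "'a::cstar_algebra"
  assumes a: "cstar_positive a" and e: "0 < e"
  shows "invertible_elt (a + e *\<^sub>R 1)"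
proof -
  have "complex_of_real (- e) \<notin> cspectrum a"
    using a e unfolding cstar_positive_def by force
  then show ?thesis by (simp add: cspectrum_iff scaleR_scaleC)
qed

lemma cabs_squared_self_adjoint:
  fixes x :: "'a::cstar_algebra"
  assumes "self_adjoint x"
  shows "(cabs x)\<^sup>2 = x * x"
proof -
  have pos: "cstar_positive (x * x)" using assms by (rule cstar_positive_square)
  have "cpow (x * x) (1/2) * cpow (x * x) (1/2) = x * x"
    using cpow_add[OF pos, of "1/2" "1/2"] cpow_1[OF pos] by simp
  then show ?thesis using assms by (simp add: cabs_def self_adjoint_def power2_eq_square)
qed

section \<open>Midpoint convex functions into the algebra\<close>

text \<open>Let \<open>h\<close> be the chord minus \<open>f\<close>; it vanishes at 0 and 1. The number \<open>s\<close> is the midpoint of an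
  endpoint \<open>t\<close> and \<open>u = 2 * s - t\<close>, so midpoint convexity gives \<open>h s \<ge> h u / 2\<close>. Every such step
  halves the lower bound \<open>- 2 * M\<close> for \<open>h\<close>, which tends to 0. Boundedness thus takes the place of
  continuity of \<open>f\<close>; this matters, as \<open>s \<mapsto> \<rho>^s\<close> may be discontinuous in norm at 0.\<close>

lemma midpoint_convex_below_chord:
  fixes f :: "real \<Rightarrow> 'a::cstar_algebra"
  assumes sa: "\<And>s. s \<in> {0..1} \<Longrightarrow> self_adjoint (f s)"
    and bdd: "\<And>s. s \<in> {0..1} \<Longrightarrow> norm (f s) \<le> M"
    and mid: "\<And>s t. s \<in> {0..1} \<Longrightarrow> t \<in> {0..1} \<Longrightarrow>
      cstar_positive (f s + f t - 2 *\<^sub>R f ((s + t) / 2))"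
    and s: "s \<in> {0..1}"
  shows "cstar_positive ((1 - s) *\<^sub>R f 0 + s *\<^sub>R f 1 - f s)"
proof -
  define h where "h s = (1 - s) *\<^sub>R f 0 + s *\<^sub>R f 1 - f s" for s
  have claim: "cstar_positive (h s + (2 * M / 2 ^ n) *\<^sub>R 1)" if "s \<in> {0..1}" for s n
    using that
  proof (induction n arbitrary: s)
    case 0
    have "norm (h s) \<le> norm ((1 - s) *\<^sub>R f 0) + norm (s *\<^sub>R f 1) + norm (f s)"
      unfolding h_def by (rule order_trans[OF norm_triangle_ineq4 add_right_mono[OF norm_triangle_ineq]])
    also have "\<dots> \<le> (1 - s) * M + s * M + M"
      using 0 by (intro add_mono) (auto intro!: mult_left_mono bdd)
    finally have "norm (h s) \<le> 2 * M" by (simp add: algebra_simps)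
    then show ?case
      using 0 by (intro cstar_positive_norm_plus) (auto simp: h_def intro!: self_adjoint_simps sa)
  next
    case (Suc n)
    define t :: real where "t = (if s \<le> 1/2 then 0 else 1)"
    define u where "u = 2 * s - t"
    have t: "t \<in> {0..1}" and u: "u \<in> {0..1}" using Suc.prems by (auto simp: t_def u_def)
    have mid_s: "(t + u) / 2 = s" by (simp add: u_def)
    have "h t = 0" by (simp add: t_def h_def)
    have "h s + (2 * M / 2 ^ Suc n) *\<^sub>R 1
      = (1/2) *\<^sub>R ((f t + f u - 2 *\<^sub>R f s) + (h u + (2 * M / 2 ^ n) *\<^sub>R 1))"
      by (cases "s \<le> 1/2") (simp_all add: h_def t_def u_def algebra_simps scaleR_2
          flip: scaleR_add_left scaleR_diff_left)
    then show ?case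
      using mid[OF t u] Suc.IH[OF u]
      by (auto simp: mid_s intro!: cstar_positive_scaleR cstar_positive_add)
  qed
  have "(\<lambda>n. (2 * M) * (1/2) ^ n) \<longlonglongrightarrow> 0"
    by (rule LIMSEQ_power_zero[THEN tendsto_mult_right_zero]) simp
  then have "(\<lambda>n. 2 * M / 2 ^ n) \<longlonglongrightarrow> 0" by (simp add: power_divide)
  then have "(\<lambda>n. h s + (2 * M / 2 ^ n) *\<^sub>R 1) \<longlonglongrightarrow> h s + 0 *\<^sub>R 1"
    by (intro tendsto_intros)
  then have "(\<lambda>n. h s + (2 * M / 2 ^ n) *\<^sub>R 1) \<longlonglongrightarrow> h s" by simp
  then have "cstar_positive (h s)" by (rule cstar_positive_LIMSEQ[OF claim[OF s]])
  then show ?thesis by (simp only: h_def)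
qed

section \<open>Cauchy--Schwarz inequality over a commutative algebra\<close>

text \<open>With \<open>p = S x x\<close>, \<open>q = S y y\<close> and \<open>r = S x y\<close>, the usual choice \<open>z = p y - r x\<close> gives
  \<open>S z z = p * (p * q - r\<^sup>\<star> * r)\<close>, but \<open>p\<close> need not be invertible. Taking \<open>m = p + \<epsilon>\<close> in place of \<open>p\<close>
  costs only the term \<open>\<epsilon> * r\<^sup>\<star> * r\<close>, which is positive. Multiplication by the positive inverse of
  \<open>m\<close> then leaves \<open>m * q - r\<^sup>\<star> * r\<close>, and \<open>\<epsilon>\<close> tends to 0.\<close>

lemma module_Cauchy_Schwarz:
  fixes S :: "'b::ab_group_add \<Rightarrow> 'b \<Rightarrow> 'a::cstar_algebra" and act :: "'a \<Rightarrow> 'b \<Rightarrow> 'b"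
  assumes B: "cstar_subalgebra B" and one: "1 \<in> B"
    and comm: "\<And>b c. b \<in> B \<Longrightarrow> c \<in> B \<Longrightarrow> b * c = c * b"
    and in_B: "\<And>x y. S x y \<in> B"
    and add: "\<And>x y z. S x (y + z) = S x y + S x z"
    and act: "\<And>b x y. b \<in> B \<Longrightarrow> S x (act b y) = b * S x y"
    and herm: "\<And>x y. (S x y)\<^sup>\<star> = S y x"
    and pos: "\<And>x. cstar_positive (S x x)"
  shows "cstar_positive (S x x * S y y - (S x y)\<^sup>\<star> * S x y)"
proof -
  define p where "p = S x x"
  define q where "q = S y y"
  define r where "r = S x y"
  have in_B: "p \<in> B" "q \<in> B" "r \<in> B" "r\<^sup>\<star> \<in> B"
    using in_B by (auto simp: p_def q_def r_def herm)
  have neg_B: "- b \<in> B" if "b \<in> B" for b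
    using B that scaleC_minus_left[of 1 b] unfolding cstar_subalgebra_def by (metis scaleC_one)
  have rr: "cstar_positive (r\<^sup>\<star> * r)"
  proof -
    \<comment> \<open>As an element of a commutative algebra, \<open>r\<close> is normal.\<close>
    have "r\<^sup>\<star> * r = (1/2) *\<^sub>R (r\<^sup>\<star> * r + r * r\<^sup>\<star>)"
      using comm[of r "r\<^sup>\<star>"] in_B by (simp flip: scaleR_2)
    then show ?thesis
      using cstar_positive_scaleR[OF cstar_positive_symmetrized_square[of r], of "1/2"] by simp
  qed
  have shifted: "cstar_positive (p * q + e *\<^sub>R q - r\<^sup>\<star> * r)" if e: "0 < e" for e
  proof -
    define m where "m = p + e *\<^sub>R 1"
    have m_B: "m \<in> B"
      using B one in_B unfolding m_def cstar_subalgebra_def by (simp add: scaleR_scaleC)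
    define z where "z = act m y + act (- r) x"
    define w where "w = m * q - r\<^sup>\<star> * r"
    have w_B: "w \<in> B" 
      using B m_B in_B neg_B unfolding w_def cstar_subalgebra_def
      by (metis add_uminus_conv_diff)
    have xz: "S x z = e *\<^sub>R r"
      using m_B in_B comm[of r p] neg_B
      by (simp add: z_def add act flip: r_def p_def) (simp add: m_def algebra_simps)
    have yz: "S y z = w"
      using m_B in_B comm[of r "r\<^sup>\<star>"] neg_B herm[of x y]
      by (simp add: z_def add act w_def flip: r_def q_def)
    have w_sa: "w\<^sup>\<star> = w"
      using pos[of x] pos[of y] comm[OF m_B in_B(2)]
      by (simp add: w_def m_def star_diff star_mult star_add star_scaleR star_star
          cstar_positive_def self_adjoint_def flip: p_def q_def)
    have "S z z = m * S z y - r * S z x"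
      using m_B in_B neg_B by (simp add: z_def[of] add act)
    also have "\<dots> = m * w - e *\<^sub>R (r\<^sup>\<star> * r)"
      using herm[of y z] herm[of x z] comm[of r "r\<^sup>\<star>"] in_B
      by (simp add: xz yz w_sa star_scaleR flip: herm[of x z])
    finally have "m * w = S z z + e *\<^sub>R (r\<^sup>\<star> * r)" by simp
    then have mw: "cstar_positive (m * w)"
      using pos[of z] rr e by (simp add: cstar_positive_add cstar_positive_scaleR)
    have m_inv: "invertible_elt m"
      unfolding m_def p_def by (rule invertible_elt_positive_plus[OF pos e])
    have "cstar_positive m"
      unfolding m_def
      by (intro cstar_positive_add cstar_positive_scaleR)
        (use pos e cstar_positive_square[of 1] self_adjoint_simps(2) in \<open>auto simp: p_def\<close>)
    then have c: "cstar_positive (inverse_elt m)"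
      using m_inv by (rule cstar_positive_inverse_elt)
    have cw: "inverse_elt m * (m * w) = w"
      using inverse_elt(2)[OF m_inv] by (simp flip: mult.assoc)
    have "m * w * inverse_elt m = w"
      using inverse_elt(1)[OF m_inv] comm[OF m_B w_B] by (simp add: mult.assoc)
    then have "cstar_positive (inverse_elt m * (m * w))"
      by (intro cstar_positive_mult c mw) (simp add: cw)
    then show ?thesis by (simp add: cw) (simp add: w_def m_def algebra_simps)
  qed
  have "(\<lambda>n. p * q + (1 / real (Suc n)) *\<^sub>R q - r\<^sup>\<star> * r) \<longlonglongrightarrow> p * q + 0 *\<^sub>R q - r\<^sup>\<star> * r"
    by (intro tendsto_intros LIMSEQ_Suc[OF lim_1_over_n])
  then have "cstar_positive (p * q + 0 *\<^sub>R q - r\<^sup>\<star> * r)"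
    by (rule cstar_positive_LIMSEQ[rotated]) (rule shifted, simp)
  then show ?thesis by (simp add: p_def q_def r_def)
qed

section \<open>Tracial expectations and the correlation form\<close>

locale tracial_expectation_density =
  fixes B :: "'a::cstar_algebra set" and E :: "'a \<Rightarrow> 'a" and \<rho> :: 'a
  assumes subalgebra: "cstar_subalgebra B"
    and expectation: "conditional_expectation B E"
    and tracial: "tracial E"
    and density: "density_operator E \<rho>"
begin

lemma E_in: "E x \<in> B"
  and E_add: "E (x + y) = E x + E y"
  and E_scaleC: "E (w *\<^sub>C x) = w *\<^sub>C E x"
  and E_positive: "cstar_positive x \<Longrightarrow> cstar_positive (E x)"
  and E_norm: "norm (E x) \<le> norm x"
  and E_module: "b \<in> B \<Longrightarrow> c \<in> B \<Longrightarrow> E (b * x * c) = b * E x * c"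
  using expectation by (simp_all add: conditional_expectation_def)

lemma E_commute: "E (x * y) = E (y * x)"
  using tracial by (simp add: tracial_def)

lemma \<rho>_positive: "cstar_positive \<rho>" and E_\<rho>: "E \<rho> = 1"
  using density by (auto simp: density_operator_def)

lemma E_scaleR: "E (r *\<^sub>R x) = r *\<^sub>R E x"
  by (simp add: scaleR_scaleC E_scaleC)

lemma E_minus: "E (- x) = - E x"
  using E_scaleC[of "-1" x] by simp

lemma E_diff: "E (x - y) = E x - E y"
  using E_add[of x "-y"] by (simp add: E_minus)

lemma one_in: "1 \<in> B"
  using E_in[of \<rho>] by (simp add: E_\<rho>)

text \<open>Both products are values of \<open>E\<close>, at \<open>b * (c * \<rho>)\<close> and at \<open>(c * \<rho>) * b\<close>, and these agree because
  \<open>E\<close> is tracial.\<close>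

lemma B_commute:
  assumes "b \<in> B" "c \<in> B"
  shows "b * c = c * b"
proof -
  have "E (b * (c * \<rho>)) = b * c" "E ((c * \<rho>) * b) = c * b"
    using E_module[OF assms(1) one_in, of "c * \<rho>"] E_module[OF assms(2) one_in, of \<rho>]
      E_module[OF assms(2,1), of \<rho>] by (simp_all add: E_\<rho>)
  then show ?thesis using E_commute by metis
qed

text \<open>Traciality allows moving \<open>b\<close> to the front by a cyclic permutation of the factors.\<close>

lemma E_module_middle:
  assumes b: "b \<in> B"
  shows "E (x * b * y) = b * E (x * y)"
proof -
  have "E (x * b * y) = E (b * (y * x))" using E_commute[of x "b * y"] by (simp add: mult.assoc)
  also have "\<dots> = b * E (y * x)" using E_module[OF b one_in] by simp
  finally show ?thesis using E_commute[of x y] by simp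
qed

text \<open>A self-adjoint \<open>h\<close> is the difference of the positive elements \<open>h + norm h\<close> and \<open>norm h\<close>, so \<open>E\<close>
  maps it to a self-adjoint element. The general case follows by taking real and imaginary parts.\<close>

lemma E_star: "E (x\<^sup>\<star>) = (E x)\<^sup>\<star>"
proof -
  have sa: "(E h)\<^sup>\<star> = E h" if h: "self_adjoint h" for h
  proof -
    have one: "cstar_positive (1::'a)"
      using cstar_positive_square[of "1::'a"] by (simp add: self_adjoint_simps)
    have "cstar_positive (norm h *\<^sub>R (1::'a))" "cstar_positive (h + norm h *\<^sub>R 1)"
      using cstar_positive_norm_plus[OF h order_refl] cstar_positive_scaleR[OF one] by auto
    then have "self_adjoint (E (h + norm h *\<^sub>R 1) - E (norm h *\<^sub>R 1))"
      by (intro self_adjoint_simps cstar_positive_self_adjoint E_positive)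
    then show ?thesis by (simp add: self_adjoint_def E_add)
  qed
  define h where "h = x + x\<^sup>\<star>"
  define k where "k = \<i> *\<^sub>C (x - x\<^sup>\<star>)"
  have "self_adjoint h" "self_adjoint k"
    by (simp_all add: h_def k_def self_adjoint_def star_add star_diff star_star star_scaleC
        add.commute scaleC_diff_right)
  then have hk: "(E h)\<^sup>\<star> = E h" "(E k)\<^sup>\<star> = E k" using sa by auto
  have x: "x = (1/2) *\<^sub>R (h - \<i> *\<^sub>C k)" and x': "x\<^sup>\<star> = (1/2) *\<^sub>R (h + \<i> *\<^sub>C k)"
    by (simp_all add: h_def k_def scaleC_scaleC flip: scaleR_2)
  show ?thesis
    by (subst x', subst x)
      (simp only: E_scaleR E_add E_diff E_scaleC star_scaleR star_diff star_scaleC hk, simp)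
qed

text \<open>Traciality gives \<open>x\<^sup>\<star> * x\<close> and \<open>x * x\<^sup>\<star>\<close> the same value, so the symmetrized square suffices.\<close>

lemma E_square_positive: "cstar_positive (E (x\<^sup>\<star> * x))"
proof -
  have "cstar_positive (E ((1/2) *\<^sub>R (x\<^sup>\<star> * x + x * x\<^sup>\<star>)))"
    by (intro E_positive cstar_positive_scaleR cstar_positive_symmetrized_square) simp
  also have "E ((1/2) *\<^sub>R (x\<^sup>\<star> * x + x * x\<^sup>\<star>)) = (1/2) *\<^sub>R (E (x\<^sup>\<star> * x) + E (x * x\<^sup>\<star>))"
    by (simp only: E_scaleR E_add)
  also have "\<dots> = E (x\<^sup>\<star> * x)"
    unfolding E_commute[of x "x\<^sup>\<star>"] by (simp flip: scaleR_2)
  finally show ?thesis .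
qed

text \<open>A family from \<open>E (\<rho> * X\<^sup>\<star> * Y)\<close> at \<open>s = 0\<close> to \<open>E (X\<^sup>\<star> * \<rho> * Y)\<close> at \<open>s = 1\<close>; the
  correlation is the difference of its members at \<open>0\<close> and \<open>\<alpha>\<close>.\<close>

definition twisted :: "real \<Rightarrow> 'a \<Rightarrow> 'a \<Rightarrow> 'a" where
  "twisted s X Y = E (cpow \<rho> (1 - s) * X\<^sup>\<star> * cpow \<rho> s * Y)"

lemma cpow_\<rho>_star: "0 \<le> s \<Longrightarrow> (cpow \<rho> s)\<^sup>\<star> = cpow \<rho> s"
  using self_adjoint_cpow[OF \<rho>_positive] by (simp add: self_adjoint_def)

lemma twisted_add: "twisted s X (Y + Z) = twisted s X Y + twisted s X Z"
  by (simp add: twisted_def distrib_left E_add)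

lemma twisted_module: "b \<in> B \<Longrightarrow> twisted s X (b * Y) = b * twisted s X Y"
  unfolding twisted_def
  using E_module_middle[of b "cpow \<rho> (1 - s) * X\<^sup>\<star> * cpow \<rho> s" Y] by (simp add: mult.assoc)

lemma twisted_star:
  assumes "s \<in> {0..1}"
  shows "(twisted s X Y)\<^sup>\<star> = twisted s Y X"
proof -
  have "(twisted s X Y)\<^sup>\<star> = E ((Y\<^sup>\<star> * cpow \<rho> s * X) * cpow \<rho> (1 - s))"
    using assms by (simp add: twisted_def E_star[symmetric] star_mult star_star cpow_\<rho>_star mult.assoc)
  also have "\<dots> = twisted s Y X"
    unfolding twisted_def E_commute[of _ "cpow \<rho> (1 - s)"] by (simp add: mult.assoc)
  finally show ?thesis .
qed

lemma twisted_flip: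
  assumes "self_adjoint X" "self_adjoint Y"
  shows "twisted (1 - s) X Y = twisted s Y X"
  using assms E_commute[of "cpow \<rho> s * X" "cpow \<rho> (1 - s) * Y"]
  by (simp add: twisted_def self_adjoint_def mult.assoc)

lemma norm_twisted_le:
  assumes "s \<in> {0..1}"
  shows "norm (twisted s X Y) \<le> (1 + norm \<rho>) * norm X * (1 + norm \<rho>) * norm Y"
proof -
  have "norm (twisted s X Y) \<le> norm (cpow \<rho> (1 - s) * X\<^sup>\<star> * cpow \<rho> s * Y)"
    unfolding twisted_def by (rule E_norm)
  also have "\<dots> \<le> norm (cpow \<rho> (1 - s)) * norm X * norm (cpow \<rho> s) * norm Y"
    by (rule order_trans[OF norm_mult_ineq mult_right_mono],
        rule order_trans[OF norm_mult_ineq mult_right_mono],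
        rule order_trans[OF norm_mult_ineq]) simp_all
  also have "\<dots> \<le> (1 + norm \<rho>) * norm X * (1 + norm \<rho>) * norm Y"
    using assms by (intro mult_mono norm_cpow_le \<rho>_positive order_refl) auto
  finally show ?thesis .
qed

text \<open>Let \<open>V u = \<rho>^(u/2) * X * \<rho>^((1-u)/2)\<close>. Traciality collects the powers of \<open>\<rho>\<close> in
  \<open>E ((V u)\<^sup>\<star> * V v)\<close> into \<open>\<rho>^(1-w)\<close> and \<open>\<rho>^w\<close> with \<open>w = (u + v) / 2\<close>. Hence the second difference
  is the value of \<open>E\<close> at \<open>(V s - V t)\<^sup>\<star> * (V s - V t)\<close>.\<close>

lemma twisted_midpoint:
  assumes s: "s \<in> {0..1}" and t: "t \<in> {0..1}"
  shows "cstar_positive (twisted s X X + twisted t X X - 2 *\<^sub>R twisted ((s + t) / 2) X X)"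
proof -
  define P where "P u = cpow \<rho> (u / 2)" for u
  have P_star: "(P u)\<^sup>\<star> = P u" if "0 \<le> u" for u using that by (simp add: P_def cpow_\<rho>_star)
  have P_mult: "P u * P v = cpow \<rho> ((u + v) / 2)" if "0 \<le> u" "0 \<le> v" for u v
    using cpow_add[OF \<rho>_positive, of "u / 2" "v / 2"] that by (simp add: P_def add_divide_distrib)
  define V where "V u = P u * X * P (1 - u)" for u
  have cross: "E ((V u)\<^sup>\<star> * V v) = twisted ((u + v) / 2) X X" if u: "u \<in> {0..1}" and v: "v \<in> {0..1}" for u v
  proof -
    have "(V u)\<^sup>\<star> * V v = P (1 - u) * (X\<^sup>\<star> * (P u * P v) * X * P (1 - v))"
      using u v by (simp add: V_def star_mult P_star mult.assoc)
    then have "E ((V u)\<^sup>\<star> * V v) = E ((P (1 - v) * P (1 - u)) * X\<^sup>\<star> * (P u * P v) * X)"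
      using E_commute[of "P (1 - u) * (X\<^sup>\<star> * (P u * P v) * X)" "P (1 - v)"] by (simp add: mult.assoc)
    also have "\<dots> = twisted ((u + v) / 2) X X"
    proof -
      have "P (1 - v) * P (1 - u) = cpow \<rho> ((1 - v + (1 - u)) / 2)"
        by (rule P_mult) (use u v in auto)
      also have "(1 - v + (1 - u)) / 2 = 1 - (u + v) / 2" by (simp add: field_simps)
      finally show ?thesis using u v by (simp add: P_mult twisted_def)
    qed
    finally show ?thesis .
  qed
  have "(V s - V t)\<^sup>\<star> * (V s - V t) = (V s)\<^sup>\<star> * V s + (V t)\<^sup>\<star> * V t - ((V s)\<^sup>\<star> * V t + (V t)\<^sup>\<star> * V s)"
    by (simp add: star_diff algebra_simps)
  then have "E ((V s - V t)\<^sup>\<star> * (V s - V t)) = twisted s X X + twisted t X X - 2 *\<^sub>R twisted ((s + t) / 2) X X"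
    using s t by (simp add: E_diff E_add cross add.commute[of t s] scaleR_2)
  then show ?thesis using E_square_positive by metis
qed

text \<open>The extension of \<open>Re Corr\<close> from self-adjoint arguments to a form on the whole algebra that is
  sesquilinear over \<open>B\<close>; see \<open>cRe_Corr\<close> below.\<close>

definition symmetrized_corr :: "real \<Rightarrow> 'a \<Rightarrow> 'a \<Rightarrow> 'a" where
  "symmetrized_corr \<alpha> X Y =
     (1/2) *\<^sub>R (twisted 0 X Y + twisted 1 X Y - twisted \<alpha> X Y - twisted (1 - \<alpha>) X Y)"

text \<open>The sum of the chord inequalities for \<open>s \<mapsto> twisted s X X\<close> at \<open>\<alpha>\<close> and \<open>1 - \<alpha>\<close>, since the two
  chord values add up to the sum of the values at the endpoints.\<close>

lemma symmetrized_corr_positive: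
  assumes \<alpha>: "\<alpha> \<in> {0..1}"
  shows "cstar_positive (symmetrized_corr \<alpha> X X)"
proof -
  let ?f = "\<lambda>s. twisted s X X"
  have chord: "cstar_positive ((1 - s) *\<^sub>R ?f 0 + s *\<^sub>R ?f 1 - ?f s)" if "s \<in> {0..1}" for s
    using midpoint_convex_below_chord[of ?f, OF _ norm_twisted_le twisted_midpoint that]
      twisted_star by (auto simp: self_adjoint_def)
  have "cstar_positive ((1/2) *\<^sub>R (((1 - \<alpha>) *\<^sub>R ?f 0 + \<alpha> *\<^sub>R ?f 1 - ?f \<alpha>)
      + ((1 - (1 - \<alpha>)) *\<^sub>R ?f 0 + (1 - \<alpha>) *\<^sub>R ?f 1 - ?f (1 - \<alpha>))))"
    using \<alpha> by (intro cstar_positive_scaleR cstar_positive_add chord) auto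
  then show ?thesis by (simp add: symmetrized_corr_def algebra_simps)
qed

lemma symmetrized_corr_Cauchy_Schwarz:
  assumes \<alpha>: "\<alpha> \<in> {0..1}"
  shows "cstar_positive (symmetrized_corr \<alpha> X X * symmetrized_corr \<alpha> Y Y
    - (symmetrized_corr \<alpha> X Y)\<^sup>\<star> * symmetrized_corr \<alpha> X Y)"
proof (rule module_Cauchy_Schwarz[where act = "(*)", OF subalgebra one_in B_commute])
  show "symmetrized_corr \<alpha> X Y \<in> B" for X Y
    unfolding symmetrized_corr_def twisted_def E_add[symmetric] E_diff[symmetric] E_scaleR[symmetric]
    by (rule E_in)
  show "symmetrized_corr \<alpha> X (Y + Z) = symmetrized_corr \<alpha> X Y + symmetrized_corr \<alpha> X Z" for X Y Z
    by (simp add: symmetrized_corr_def twisted_add algebra_simps)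
  show "symmetrized_corr \<alpha> X (b * Y) = b * symmetrized_corr \<alpha> X Y" if "b \<in> B" for b X Y
    using that by (simp add: symmetrized_corr_def twisted_module algebra_simps)
  show "(symmetrized_corr \<alpha> X Y)\<^sup>\<star> = symmetrized_corr \<alpha> Y X" for X Y
    using \<alpha> by (simp add: symmetrized_corr_def star_scaleR star_add star_diff twisted_star)
qed (use symmetrized_corr_positive[OF \<alpha>] in auto)

lemma Corr_eq_twisted: "Corr \<alpha> \<rho> E X Y = twisted 0 X Y - twisted \<alpha> X Y"
  by (simp add: Corr_def twisted_def cpow_1[OF \<rho>_positive])

text \<open>For self-adjoint arguments, exchanging them amounts to replacing \<open>s\<close> by \<open>1 - s\<close>, and taking the
  adjoint exchanges them too. So the adjoint of \<open>Corr\<close> contributes the terms for 1 and \<open>1 - \<alpha>\<close>.\<close>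

lemma cRe_Corr:
  assumes "\<alpha> \<in> {0..1}" "self_adjoint X" "self_adjoint Y"
  shows "cRe (Corr \<alpha> \<rho> E X Y) = symmetrized_corr \<alpha> X Y"
  using assms twisted_flip[of X Y 0] twisted_flip[of X Y \<alpha>]
  by (simp add: cRe_def Corr_eq_twisted symmetrized_corr_def star_diff twisted_star algebra_simps)

lemma WYD_info_eq:
  assumes "self_adjoint X"
  shows "WYD_info \<alpha> \<rho> E X = symmetrized_corr \<alpha> X X"
proof -
  have "twisted 0 X X + twisted 1 X X - twisted \<alpha> X X - twisted (1 - \<alpha>) X X
      = 2 *\<^sub>R (twisted 0 X X - twisted \<alpha> X X)"
    using twisted_flip[OF assms assms, of 0] twisted_flip[OF assms assms, of \<alpha>]
    by (simp add: scaleR_2)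
  then show ?thesis by (simp add: WYD_info_def Corr_eq_twisted symmetrized_corr_def)
qed

end

theorem theorem3p5:
  fixes \<B> :: "'a::cstar_algebra set" and \<E> :: "'a \<Rightarrow> 'a"
    and \<alpha> :: real and \<rho> A B :: 'a
  assumes "cstar_subalgebra \<B>"
    and "conditional_expectation \<B> \<E>"
    and "tracial \<E>"
    and "0 \<le> \<alpha>" and "\<alpha> \<le> 1"
    and "density_operator \<E> \<rho>"
    and "self_adjoint A" and "self_adjoint B"
  shows "(cabs (cRe (Corr \<alpha> \<rho> \<E> A B)))\<^sup>2 \<le>\<^sub>A WYD_info \<alpha> \<rho> \<E> A * WYD_info \<alpha> \<rho> \<E> B"
proof -
  interpret tracial_expectation_density \<B> \<E> \<rho>
    by standard (use assms in auto)
  have \<alpha>: "\<alpha> \<in> {0..1}" using assms by simp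
  define R where "R = cRe (Corr \<alpha> \<rho> \<E> A B)"
  have "R\<^sup>\<star> = R" using self_adjoint_cRe unfolding R_def self_adjoint_def by blast
  then have "(cabs R)\<^sup>2 = R\<^sup>\<star> * R"
    using cabs_squared_self_adjoint[of R] by (simp add: self_adjoint_def)
  then show ?thesis
    using symmetrized_corr_Cauchy_Schwarz[OF \<alpha>, of A B] assms \<alpha>
    by (simp add: cstar_le_def R_def cRe_Corr WYD_info_eq)
qed

end
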